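(* Let $\Lambda$ be a discrete valuation ring and let $\alpha,\beta,\gamma$ be partitions. Suppose $\Gamma$ is an LR-tableau of shape $\beta\setminus\gamma$ and content $\alpha$ such that $\beta\setminus\gamma$ is a horizontal strip. Then there exists an embedding $(A\subset B)$ of finite length $\Lambda$-modules which is a direct sum of cyclic embeddings and which has tableau $\Gamma$.
   Context: $\Lambda$ is a discrete valuation ring with maximal ideal generator $p$. For a partition $\alpha=(\alpha_1\ge\dots\ge\alpha_n)$ put $N_\alpha=\bigoplus_i\Lambda/(p^{\alpha_i})$. An embedding $(A\subset B)$ is a finite length $\Lambda$-module $B$ with a submodule $A$; direct sums are taken componentwise. It is cyclic if $A$ is a cyclic $\Lambda$-module (possibly zero). A partition $\beta$ is drawn as a Young diagram whose $i$-th column (from the left) has length $\beta_i$. The skew diagram $\beta\setminus\gamma$ is a horizontal strip if $\beta_i\le\gamma_i+1$ for all $i$ (so each column of $\beta\setminus\gamma$ has at most one box). An LR-tableau of shape $\beta\setminus\gamma$ and content $\alpha$ is a Young diagram of shape $\beta$ in which the region $\gamma$ is left empty and the region $\beta\setminus\gamma$ is filled with $(\alpha')_1$ entries 1, $(\alpha')_2$ entries 2, etc. ($\alpha'$ the transpose of $\alpha$) such that: in each row the entries are weakly increasing; in each column the entries are strictly increasing; and on the right hand side of each column there occur at least as many entries $e$ as entries $e+1$ ($e=1,2,\dots$). It is encoded by the chain of partitions $[\gamma^{(0)},\dots,\gamma^{(r)}]$ with $\gamma^{(0)}=\gamma$, $\gamma^{(r)}=\beta$, where the boxes of $\gamma^{(e)}\setminus\gamma^{(e-1)}$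 carry the entry $e$. The LR-tableau of an embedding $(A\subset B)$, where $A$ has Loewy length $r$ (the least $r$ with $p^rA=0$), is $[\gamma^{(0)},\dots,\gamma^{(r)}]$ with $N_{\gamma^{(e)}}\cong B/p^eA$. *)

theory Defs
  imports "HOL-Algebra.Module" "HOL-Algebra.Ring_Divisibility"
begin

section \<open>Discrete valuation rings\<close>

definition discrete_valuation_ring :: "('a, 'r) ring_scheme \<Rightarrow> bool" where
  "discrete_valuation_ring R \<longleftrightarrow>
     principal_domain R \<and> \<not> field R \<and> (\<exists>!M. maximalideal M R)"

definition uniformizer :: "('a, 'r) ring_scheme \<Rightarrow> 'a \<Rightarrow> bool" where
  "uniformizer R p \<longleftrightarrow> p \<in> carrier R \<and> maximalideal (PIdl\<^bsub>R\<^esub> p) R"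


section \<open>Modules\<close>

text \<open>Module records extend ring records, so the constructions below have to supply
  the fields \<open>mult\<close> and \<open>one\<close>. These play no role for modules and are left undefined.\<close>

definition regular_module :: "('a, 'r) ring_scheme \<Rightarrow> ('a, 'a) module" where
  "regular_module R =
     \<lparr>carrier = carrier R, mult = undefined, one = undefined,
      zero = \<zero>\<^bsub>R\<^esub>, add = (\<oplus>\<^bsub>R\<^esub>), smult = (\<otimes>\<^bsub>R\<^esub>)\<rparr>"

definition quotient_module :: "('a, 'm) module \<Rightarrow> 'm set \<Rightarrow> ('a, 'm set) module" where
  "quotient_module M H =
     \<lparr>carrier = a_rcosets\<^bsub>M\<^esub> H, mult = undefined, one = undefined,
      zero = H, add = set_add M,
      smult = (\<lambda>a X. \<Union>x\<in>X. H +>\<^bsub>M\<^esub> (a \<odot>\<^bsub>M\<^esub> x))\<rparr>"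

text \<open>For a finite index set, the only case used here, the direct sum is the full product.\<close>

definition direct_sum :: "'i set \<Rightarrow> ('i \<Rightarrow> ('a, 'm) module) \<Rightarrow> ('a, 'i \<Rightarrow> 'm) module" where
  "direct_sum I M =
     \<lparr>carrier = (\<Pi>\<^sub>E i\<in>I. carrier (M i)), mult = undefined, one = undefined,
      zero = (\<lambda>i\<in>I. \<zero>\<^bsub>M i\<^esub>),
      add = (\<lambda>x y. \<lambda>i\<in>I. x i \<oplus>\<^bsub>M i\<^esub> y i),
      smult = (\<lambda>a x. \<lambda>i\<in>I. a \<odot>\<^bsub>M i\<^esub> x i)\<rparr>"

definition module_iso ::
  "('a, 'r) ring_scheme \<Rightarrow> ('a, 'm) module \<Rightarrow> ('a, 'n) module \<Rightarrow> ('m \<Rightarrow> 'n) set" where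
  "module_iso R M N =
     {f. bij_betw f (carrier M) (carrier N) \<and>
         (\<forall>x\<in>carrier M. \<forall>y\<in>carrier M. f (x \<oplus>\<^bsub>M\<^esub> y) = f x \<oplus>\<^bsub>N\<^esub> f y) \<and>
         (\<forall>a\<in>carrier R. \<forall>x\<in>carrier M. f (a \<odot>\<^bsub>M\<^esub> x) = a \<odot>\<^bsub>N\<^esub> f x)}"

definition isomorphic_modules ::
  "('a, 'r) ring_scheme \<Rightarrow> ('a, 'm) module \<Rightarrow> ('a, 'n) module \<Rightarrow> bool" where
  "isomorphic_modules R M N \<longleftrightarrow> module_iso R M N \<noteq> {}"

text \<open>A module has finite length if it has a composition series.\<close>

definition finite_length :: "('a, 'r) ring_scheme \<Rightarrow> ('a, 'm) module \<Rightarrow> bool" where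
  "finite_length R M \<longleftrightarrow>
     (\<exists>Hs. Hs \<noteq> [] \<and> hd Hs = {\<zero>\<^bsub>M\<^esub>} \<and> last Hs = carrier M \<and>
        (\<forall>H\<in>set Hs. submodule H R M) \<and>
        (\<forall>i. Suc i < length Hs \<longrightarrow> Hs ! i \<subset> Hs ! Suc i \<and>
           \<not> (\<exists>K. submodule K R M \<and> Hs ! i \<subset> K \<and> K \<subset> Hs ! Suc i)))"

definition cyclic_submodule ::
  "('a, 'r) ring_scheme \<Rightarrow> 'm set \<Rightarrow> ('a, 'm) module \<Rightarrow> bool" where
  "cyclic_submodule R A M \<longleftrightarrow>
     submodule A R M \<and> (\<exists>a\<in>A. A = {r \<odot>\<^bsub>M\<^esub> a | r. r \<in> carrier R})"

text \<open>The submodule \<open>p\<^sup>e A\<close> of \<open>M\<close>.\<close>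

definition power_multiple ::
  "('a, 'r) ring_scheme \<Rightarrow> 'a \<Rightarrow> ('a, 'm) module \<Rightarrow> nat \<Rightarrow> 'm set \<Rightarrow> 'm set" where
  "power_multiple R p M e A = (\<lambda>x. (p [^]\<^bsub>R\<^esub> e) \<odot>\<^bsub>M\<^esub> x) ` A"

definition loewy_length ::
  "('a, 'r) ring_scheme \<Rightarrow> 'a \<Rightarrow> 'm set \<Rightarrow> ('a, 'm) module \<Rightarrow> nat" where
  "loewy_length R p A M = (LEAST r. power_multiple R p M r A = {\<zero>\<^bsub>M\<^esub>})"


section \<open>Partitions and Littlewood-Richardson tableaux\<close>

text \<open>A partition is an eventually vanishing weakly decreasing sequence; parts are indexed
  from \<open>0\<close>, so \<open>\<alpha> i\<close> is the part usually written with index \<open>i + 1\<close>.\<close>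

definition is_partition :: "(nat \<Rightarrow> nat) \<Rightarrow> bool" where
  "is_partition \<alpha> \<longleftrightarrow> antimono \<alpha> \<and> finite {i. \<alpha> i \<noteq> 0}"

text \<open>The transpose, in contrast, is indexed from \<open>1\<close>, its index being a tableau entry.\<close>

definition transpose_part :: "(nat \<Rightarrow> nat) \<Rightarrow> nat \<Rightarrow> nat" where
  "transpose_part \<alpha> e = card {i. e \<le> \<alpha> i}"

text \<open>Boxes are pairs (row, column), both counted from \<open>0\<close>, rows from top to bottom and
  columns from left to right; the parts of a partition are the lengths of the columns.\<close>

definition young_diagram :: "(nat \<Rightarrow> nat) \<Rightarrow> (nat \<times> nat) set" where
  "young_diagram \<beta> = {(j, i). j < \<beta> i}"

definition skew_diagram :: "(nat \<Rightarrow> nat) \<Rightarrow> (nat \<Rightarrow> nat) \<Rightarrow> (nat \<times> nat) set" where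
  "skew_diagram \<beta> \<gamma> = young_diagram \<beta> - young_diagram \<gamma>"

definition horizontal_strip :: "(nat \<Rightarrow> nat) \<Rightarrow> (nat \<Rightarrow> nat) \<Rightarrow> bool" where
  "horizontal_strip \<beta> \<gamma> \<longleftrightarrow> (\<forall>i. \<beta> i \<le> \<gamma> i + 1)"

text \<open>\<open>T (j, i)\<close> is the entry in row \<open>j\<close> and column \<open>i\<close>; values of \<open>T\<close> outside the skew
  diagram are irrelevant.\<close>

definition LR_tableau ::
  "(nat \<Rightarrow> nat) \<Rightarrow> (nat \<Rightarrow> nat) \<Rightarrow> (nat \<Rightarrow> nat) \<Rightarrow> (nat \<times> nat \<Rightarrow> nat) \<Rightarrow> bool" where
  "LR_tableau \<alpha> \<beta> \<gamma> T \<longleftrightarrow>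
     young_diagram \<gamma> \<subseteq> young_diagram \<beta> \<and>
     (\<forall>b\<in>skew_diagram \<beta> \<gamma>. 1 \<le> T b) \<and>
     (\<forall>e\<ge>1. card {b \<in> skew_diagram \<beta> \<gamma>. T b = e} = transpose_part \<alpha> e) \<and>
     (\<forall>j i i'. (j, i) \<in> skew_diagram \<beta> \<gamma> \<and> (j, i') \<in> skew_diagram \<beta> \<gamma> \<and> i < i'
        \<longrightarrow> T (j, i) \<le> T (j, i')) \<and>
     (\<forall>j j' i. (j, i) \<in> skew_diagram \<beta> \<gamma> \<and> (j', i) \<in> skew_diagram \<beta> \<gamma> \<and> j < j'
        \<longrightarrow> T (j, i) < T (j', i)) \<and>
     (\<forall>c. \<forall>e\<ge>1. card {(j, i) \<in> skew_diagram \<beta> \<gamma>. c < i \<and> T (j, i) = e + 1}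
               \<le> card {(j, i) \<in> skew_diagram \<beta> \<gamma>. c < i \<and> T (j, i) = e})"

text \<open>The partition whose diagram consists of the empty boxes and those with entry at most \<open>e\<close>,
  and the resulting chain, in which \<open>e\<close> runs from \<open>0\<close> to the largest part \<open>\<alpha> 0\<close>, i.e. to
  the number of parts of the transpose.\<close>

definition tableau_partition ::
  "(nat \<Rightarrow> nat) \<Rightarrow> (nat \<Rightarrow> nat) \<Rightarrow> (nat \<times> nat \<Rightarrow> nat) \<Rightarrow> nat \<Rightarrow> nat \<Rightarrow> nat" where
  "tableau_partition \<beta> \<gamma> T e i = card {j. j < \<beta> i \<and> (j < \<gamma> i \<or> T (j, i) \<le> e)}"

definition tableau_chain ::
  "(nat \<Rightarrow> nat) \<Rightarrow> (nat \<Rightarrow> nat) \<Rightarrow> (nat \<Rightarrow> nat) \<Rightarrow> (nat \<times> nat \<Rightarrow> nat) \<Rightarrow> (nat \<Rightarrow> nat) list" where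
  "tableau_chain \<alpha> \<beta> \<gamma> T = map (tableau_partition \<beta> \<gamma> T) [0..<Suc (\<alpha> 0)]"


section \<open>Embeddings\<close>

definition partition_module ::
  "('a, 'r) ring_scheme \<Rightarrow> 'a \<Rightarrow> (nat \<Rightarrow> nat) \<Rightarrow> ('a, nat \<Rightarrow> 'a set) module" where
  "partition_module R p \<alpha> =
     direct_sum {i. \<alpha> i \<noteq> 0}
       (\<lambda>i. quotient_module (regular_module R) (PIdl\<^bsub>R\<^esub> (p [^]\<^bsub>R\<^esub> \<alpha> i)))"

definition embedding :: "('a, 'r) ring_scheme \<Rightarrow> 'm set \<Rightarrow> ('a, 'm) module \<Rightarrow> bool" where
  "embedding R A B \<longleftrightarrow> module R B \<and> finite_length R B \<and> submodule A R B"

definition cyclic_embedding ::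
  "('a, 'r) ring_scheme \<Rightarrow> 'm set \<Rightarrow> ('a, 'm) module \<Rightarrow> bool" where
  "cyclic_embedding R A B \<longleftrightarrow> embedding R A B \<and> cyclic_submodule R A B"

definition isomorphic_embeddings ::
  "('a, 'r) ring_scheme \<Rightarrow> 'm set \<Rightarrow> ('a, 'm) module \<Rightarrow> 'n set \<Rightarrow> ('a, 'n) module \<Rightarrow> bool" where
  "isomorphic_embeddings R A B A' B' \<longleftrightarrow> (\<exists>f\<in>module_iso R B B'. f ` A = A')"

text \<open>Requiring the summands to have the element type of \<open>B\<close> is no restriction, since
  every direct summand of \<open>B\<close> is isomorphic to a submodule of \<open>B\<close>.\<close>

definition direct_sum_of_cyclic_embeddings ::
  "('a, 'r) ring_scheme \<Rightarrow> 'm set \<Rightarrow> ('a, 'm) module \<Rightarrow> bool" where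
  "direct_sum_of_cyclic_embeddings R A B \<longleftrightarrow>
     (\<exists>(n::nat) (As :: nat \<Rightarrow> 'm set) (Bs :: nat \<Rightarrow> ('a, 'm) module).
        (\<forall>i<n. cyclic_embedding R (As i) (Bs i)) \<and>
        isomorphic_embeddings R A B (\<Pi>\<^sub>E i\<in>{..<n}. As i) (direct_sum {..<n} Bs))"

definition has_tableau ::
  "('a, 'r) ring_scheme \<Rightarrow> 'a \<Rightarrow> 'm set \<Rightarrow> ('a, 'm) module \<Rightarrow> (nat \<Rightarrow> nat) list \<Rightarrow> bool" where
  "has_tableau R p A B \<Gamma> \<longleftrightarrow>
     length \<Gamma> = Suc (loewy_length R p A B) \<and>
     (\<forall>e<length \<Gamma>. is_partition (\<Gamma> ! e) \<and>
        isomorphic_modules R (partition_module R p (\<Gamma> ! e))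
          (quotient_module B (power_multiple R p B e A)))"

end

theory Submission
  imports Defs
begin

text \<open>In a horizontal strip every column \<open>i\<close> has at most one box; let \<open>c i\<close> be its entry, or \<open>0\<close>
  if there is none. The lattice condition, read from the right, allows every column with entry
  \<open>e + 1\<close> to be matched injectively with a column to its right with entry \<open>e\<close>
  (\<open>injection_to_the_right\<close>), and since rows increase weakly the matched column is strictly
  shorter (\<open>predecessor_shorter\<close>). Following the matching splits the columns into chains with
  entries \<open>1, 2, \<dots>, k\<close> and strictly increasing lengths, besides the columns without a box, each of
  which is a chain on its own.

  Let \<open>B\<close> be the sum of the modules \<open>R/(p\<^bsup>\<beta> i\<^esup>)\<close> with generators \<open>x\<^sub>i\<close>. A chain \<open>C\<close> contributes the
  element \<open>a\<^sub>C\<close>, the sum of the \<open>p\<^bsup>\<beta> i - c i\<^esup> x\<^sub>i\<close> over \<open>i\<close> in \<open>C\<close>, and \<open>A\<close> is generated by the \<open>a\<^sub>C\<close>.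
  Grouping the columns by chains exhibits \<open>A\<close> in \<open>B\<close> as a direct sum of cyclic embeddings
  (\<open>ex_direct_sum_iso\<close>); a column without a box contributes \<open>p\<^bsup>\<beta> i\<^esup> x\<^sub>i = 0\<close>.

  It remains to see that \<open>B/p\<^sup>sA\<close> is the sum of the cyclic modules of length \<open>\<beta> i - 1\<close> if \<open>c i > s\<close>
  and of length \<open>\<beta> i\<close> otherwise, these being the column lengths of the diagram of the boxes that
  are empty or have entry at most \<open>s\<close>. If \<open>j\<close> precedes \<open>i\<close> in a chain, then
  \<open>p\<^sup>sa\<^sub>C\<close> has the coordinates \<open>p\<^bsup>\<beta> i - c i + s\<^esup>\<close> and \<open>p\<^bsup>\<beta> j - c j + s\<^esup>\<close> there, and the first is
  \<open>p\<^bsup>\<beta> i - \<beta> j - 1\<^esup>\<close> times the second. Subtracting this multiple is a unitriangular change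
  of coordinates, after which only the coordinate at the column with entry \<open>s + 1\<close> is left of
  \<open>p\<^sup>sa\<^sub>C\<close>, namely \<open>p\<^bsup>\<beta> i - 1\<^esup>\<close>. Moreover the relation \<open>p\<^bsup>\<beta> j\<^esup> x\<^sub>j = 0\<close> at a column \<open>j\<close> with entry
  above \<open>s\<close> turns into one that kills \<open>p\<^bsup>\<beta> i - 1\<^esup>\<close> at its successor \<open>i\<close>. So every column with entry above \<open>s\<close> loses
  exactly one box (\<open>reduced_coord_of_combination\<close>, \<open>combination_of_reduced_coord\<close>,
  \<open>quotient_by_power_multiple\<close>). The Loewy length of \<open>A\<close> is then the largest entry, which is
  \<open>\<alpha> 0\<close> because the number of entries \<open>e\<close> is the \<open>e\<close>-th part of the transpose of \<open>\<alpha>\<close>.\<close>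

section \<open>Surjective linear maps\<close>

definition module_epi ::
  "('a, 'r) ring_scheme \<Rightarrow> ('a, 'm) module \<Rightarrow> ('a, 'n) module \<Rightarrow> ('m \<Rightarrow> 'n) \<Rightarrow> bool" where
  "module_epi R M N f \<longleftrightarrow>
     f ` carrier M = carrier N \<and> f \<zero>\<^bsub>M\<^esub> = \<zero>\<^bsub>N\<^esub> \<and>
     (\<forall>x\<in>carrier M. \<forall>y\<in>carrier M. f (x \<oplus>\<^bsub>M\<^esub> y) = f x \<oplus>\<^bsub>N\<^esub> f y) \<and>
     (\<forall>a\<in>carrier R. \<forall>x\<in>carrier M. f (a \<odot>\<^bsub>M\<^esub> x) = a \<odot>\<^bsub>N\<^esub> f x)"

lemma module_epiD:
  assumes "module_epi R M N f"
  shows "f ` carrier M = carrier N" "f \<zero>\<^bsub>M\<^esub> = \<zero>\<^bsub>N\<^esub>"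
    "\<And>x y. x \<in> carrier M \<Longrightarrow> y \<in> carrier M \<Longrightarrow> f (x \<oplus>\<^bsub>M\<^esub> y) = f x \<oplus>\<^bsub>N\<^esub> f y"
    "\<And>a x. a \<in> carrier R \<Longrightarrow> x \<in> carrier M \<Longrightarrow> f (a \<odot>\<^bsub>M\<^esub> x) = a \<odot>\<^bsub>N\<^esub> f x"
    "\<And>x. x \<in> carrier M \<Longrightarrow> f x \<in> carrier N"
  using assms unfolding module_epi_def by auto

lemma module_epi_module:
  assumes M: "module R M" and f: "module_epi R M N f"
  shows "module R N"
proof -
  interpret module R M by fact
  note fD = module_epiD[OF f]
  have ex: "\<exists>x\<in>carrier M. n = f x" if "n \<in> carrier N" for n
    using that fD(1) by auto
  show ?thesis
  proof (rule moduleI)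
    show "cring R" ..
    show "abelian_group N"
    proof (rule abelian_groupI)
      fix x y z assume "x \<in> carrier N" "y \<in> carrier N" "z \<in> carrier N"
      then obtain x' y' z' where
        x: "x' \<in> carrier M" "x = f x'" and y: "y' \<in> carrier M" "y = f y'"
        and z: "z' \<in> carrier M" "z = f z'" using ex by meson
      show "x \<oplus>\<^bsub>N\<^esub> y \<oplus>\<^bsub>N\<^esub> z = x \<oplus>\<^bsub>N\<^esub> (y \<oplus>\<^bsub>N\<^esub> z)"
        using x y z by (simp add: fD(3)[symmetric] M.a_assoc)
    next
      fix x y assume "x \<in> carrier N" "y \<in> carrier N"
      then obtain x' y' where
        x: "x' \<in> carrier M" "x = f x'" and y: "y' \<in> carrier M" "y = f y'" using ex by meson
      show "x \<oplus>\<^bsub>N\<^esub> y \<in> carrier N" "x \<oplus>\<^bsub>N\<^esub> y = y \<oplus>\<^bsub>N\<^esub> x"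
        using x y by (simp_all add: fD(3,5) M.a_comm flip: fD(3))
    next
      show "\<zero>\<^bsub>N\<^esub> \<in> carrier N" using fD(5)[of "\<zero>\<^bsub>M\<^esub>"] fD(2) by simp
    next
      fix x assume "x \<in> carrier N"
      then obtain x' where x: "x' \<in> carrier M" "x = f x'" using ex by meson
      show "\<zero>\<^bsub>N\<^esub> \<oplus>\<^bsub>N\<^esub> x = x"
        using x by (simp flip: fD(2,3))
      have "f (\<ominus>\<^bsub>M\<^esub> x') \<oplus>\<^bsub>N\<^esub> x = \<zero>\<^bsub>N\<^esub>"
        using x by (simp add: M.l_neg flip: fD(2,3))
      then show "\<exists>y\<in>carrier N. y \<oplus>\<^bsub>N\<^esub> x = \<zero>\<^bsub>N\<^esub>"
        using x fD(5) by blast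
    qed
  next
    fix a x y assume a: "a \<in> carrier R" and "x \<in> carrier N" "y \<in> carrier N"
    then obtain x' y' where
      x: "x' \<in> carrier M" "x = f x'" and y: "y' \<in> carrier M" "y = f y'" using ex by meson
    show "a \<odot>\<^bsub>N\<^esub> (x \<oplus>\<^bsub>N\<^esub> y) = a \<odot>\<^bsub>N\<^esub> x \<oplus>\<^bsub>N\<^esub> a \<odot>\<^bsub>N\<^esub> y"
      using a x y by (simp add: smult_r_distr flip: fD(3,4))
  next
    fix a b x assume a: "a \<in> carrier R" "b \<in> carrier R" and "x \<in> carrier N"
    then obtain x' where x: "x' \<in> carrier M" "x = f x'" using ex by meson
    show "(a \<oplus>\<^bsub>R\<^esub> b) \<odot>\<^bsub>N\<^esub> x = a \<odot>\<^bsub>N\<^esub> x \<oplus>\<^bsub>N\<^esub> b \<odot>\<^bsub>N\<^esub> x"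
      and "(a \<otimes>\<^bsub>R\<^esub> b) \<odot>\<^bsub>N\<^esub> x = a \<odot>\<^bsub>N\<^esub> (b \<odot>\<^bsub>N\<^esub> x)"
      using a x by (simp_all add: smult_l_distr smult_assoc1 flip: fD(3,4))
  next
    fix a x assume a: "a \<in> carrier R" and "x \<in> carrier N"
    then obtain x' where x: "x' \<in> carrier M" "x = f x'" using ex by meson
    show "a \<odot>\<^bsub>N\<^esub> x \<in> carrier N"
      using a x by (simp add: fD(5) flip: fD(4))
  next
    fix x assume "x \<in> carrier N"
    then obtain x' where x: "x' \<in> carrier M" "x = f x'" using ex by meson
    show "\<one>\<^bsub>R\<^esub> \<odot>\<^bsub>N\<^esub> x = x"
      using x by (simp flip: fD(4))
  qed
qed

lemma module_epi_compose:
  assumes "module_epi R M N f" "module_epi R N K g"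
  shows "module_epi R M K (g \<circ> f)"
proof -
  note fD = module_epiD[OF assms(1)] and gD = module_epiD[OF assms(2)]
  have "(g \<circ> f) ` carrier M = carrier K"
    by (simp only: image_comp[symmetric] fD(1) gD(1))
  then show ?thesis
    by (simp add: module_epi_def fD(2-5) gD(2-5))
qed

lemma module_epi_eq_iff:
  assumes M: "module R M" and f: "module_epi R M N f" and x: "x \<in> carrier M" "y \<in> carrier M"
  shows "f x = f y \<longleftrightarrow> f (x \<ominus>\<^bsub>M\<^esub> y) = \<zero>\<^bsub>N\<^esub>"
proof -
  interpret module R M by fact
  interpret N: module R N by (rule module_epi_module[OF M f])
  note fD = module_epiD[OF f]
  have neg: "f (\<ominus>\<^bsub>M\<^esub> y) = \<ominus>\<^bsub>N\<^esub> f y"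
    using N.M.minus_equality[of "f (\<ominus>\<^bsub>M\<^esub> y)" "f y"] x
    by (simp add: fD(5) M.l_neg fD(2) flip: fD(3))
  show ?thesis
    using x by (simp add: a_minus_def fD(3) neg fD(5) N.M.add.inv_solve_right' N.M.l_zero)
qed

text \<open>Presenting two modules as images of a third reduces an isomorphism between them to a comparison
  of kernels, with no map between the two to be shown well defined.\<close>

lemma isomorphic_modules_if_same_kernel:
  assumes M: "module R M" and f: "module_epi R M N f" and g: "module_epi R M K g"
    and ker: "\<And>x. x \<in> carrier M \<Longrightarrow> f x = \<zero>\<^bsub>N\<^esub> \<longleftrightarrow> g x = \<zero>\<^bsub>K\<^esub>"
  shows "isomorphic_modules R N K"
proof -
  interpret module R M by fact
  note fD = module_epiD[OF f] and gD = module_epiD[OF g]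
  have eq: "f x = f y \<longleftrightarrow> g x = g y" if "x \<in> carrier M" "y \<in> carrier M" for x y
    using that ker by (simp add: module_epi_eq_iff[OF M f] module_epi_eq_iff[OF M g])
  define h where "h n = g (SOME x. x \<in> carrier M \<and> f x = n)" for n
  have h: "h (f x) = g x" if "x \<in> carrier M" for x
  proof -
    define y where "y = (SOME y. y \<in> carrier M \<and> f y = f x)"
    have "y \<in> carrier M \<and> f y = f x"
      unfolding y_def using someI_ex[of "\<lambda>y. y \<in> carrier M \<and> f y = f x"] that by blast
    then show ?thesis using that eq[of y x] by (simp add: h_def y_def)
  qed
  have ex: "\<exists>x\<in>carrier M. n = f x" if "n \<in> carrier N" for n
    using that fD(1) by auto
  have "inj_on h (carrier N)"
  proof (rule inj_onI)
    fix n m assume "n \<in> carrier N" "m \<in> carrier N" and hnm: "h n = h m"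
    then obtain x y where x: "x \<in> carrier M" "n = f x" and y: "y \<in> carrier M" "m = f y"
      using ex by meson
    then show "n = m" using hnm eq[of x y] by (simp add: h)
  qed
  moreover have "h ` carrier N = carrier K"
  proof -
    have "h ` carrier N = (\<lambda>x. h (f x)) ` carrier M" by (simp only: fD(1)[symmetric] image_image)
    also have "\<dots> = g ` carrier M" by (rule image_cong) (simp_all add: h)
    finally show ?thesis by (simp only: gD(1))
  qed
  moreover have "h (n \<oplus>\<^bsub>N\<^esub> m) = h n \<oplus>\<^bsub>K\<^esub> h m"
    if nm: "n \<in> carrier N" "m \<in> carrier N" for n m
  proof -
    obtain x y where x: "x \<in> carrier M" "n = f x" and y: "y \<in> carrier M" "m = f y"
      using ex nm by meson
    then show ?thesis using h[of "x \<oplus>\<^bsub>M\<^esub> y"] by (simp add: h fD(3) gD(3))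
  qed
  moreover have "h (a \<odot>\<^bsub>N\<^esub> n) = a \<odot>\<^bsub>K\<^esub> h n"
    if a: "a \<in> carrier R" and n: "n \<in> carrier N" for a n
  proof -
    obtain x where x: "x \<in> carrier M" "n = f x" using ex n by meson
    then show ?thesis using a h[of "a \<odot>\<^bsub>M\<^esub> x"] by (simp add: h fD(4) gD(4))
  qed
  ultimately have "h \<in> module_iso R N K"
    by (auto simp: module_iso_def bij_betw_def)
  then show ?thesis by (auto simp: isomorphic_modules_def)
qed

lemma module_epi_quotient:
  assumes M: "module R M" and H: "submodule H R M"
  shows "module_epi R M (quotient_module M H) (\<lambda>x. H +>\<^bsub>M\<^esub> x)"
proof -
  interpret module R M by fact
  interpret submodule H R M by fact
  interpret abelian_subgroup H M
    using submodule.axioms(1)[OF H] M.abelian_group_axioms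
    by (intro abelian_subgroupI3 additive_subgroup.intro)
  have sub: "H \<subseteq> carrier M" by (rule a_subset)
  have smult: "H +>\<^bsub>M\<^esub> (a \<odot>\<^bsub>M\<^esub> x) = (\<Union>y\<in>H +>\<^bsub>M\<^esub> x. H +>\<^bsub>M\<^esub> (a \<odot>\<^bsub>M\<^esub> y))"
    if a: "a \<in> carrier R" and x: "x \<in> carrier M" for a x
  proof -
    have "H +>\<^bsub>M\<^esub> (a \<odot>\<^bsub>M\<^esub> y) = H +>\<^bsub>M\<^esub> (a \<odot>\<^bsub>M\<^esub> x)" if y: "y \<in> H +>\<^bsub>M\<^esub> x" for y
    proof -
      obtain h where h: "h \<in> H" "y = h \<oplus>\<^bsub>M\<^esub> x"
        using y by (auto simp: a_r_coset_def r_coset_def)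
      have hc: "h \<in> carrier M" using h sub by auto
      have "a \<odot>\<^bsub>M\<^esub> y = a \<odot>\<^bsub>M\<^esub> h \<oplus>\<^bsub>M\<^esub> a \<odot>\<^bsub>M\<^esub> x"
        using a x hc h by (simp add: smult_r_distr)
      moreover have "a \<odot>\<^bsub>M\<^esub> h \<in> H" using a h by auto
      ultimately have "a \<odot>\<^bsub>M\<^esub> y \<in> H +>\<^bsub>M\<^esub> (a \<odot>\<^bsub>M\<^esub> x)"
        using a x sub by (simp add: a_rcosI)
      then show ?thesis
        using a_repr_independence[of "a \<odot>\<^bsub>M\<^esub> y" H "a \<odot>\<^bsub>M\<^esub> x"] a x a_subgroup by simp
    qed
    then have "(\<Union>y\<in>H +>\<^bsub>M\<^esub> x. H +>\<^bsub>M\<^esub> (a \<odot>\<^bsub>M\<^esub> y)) = (\<Union>y\<in>H +>\<^bsub>M\<^esub> x. H +>\<^bsub>M\<^esub> (a \<odot>\<^bsub>M\<^esub> x))"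
      by (rule SUP_cong[OF refl])
    moreover have "x \<in> H +>\<^bsub>M\<^esub> x" using x by (rule a_rcos_self)
    ultimately show ?thesis by blast
  qed
  have image: "(\<lambda>x. H +>\<^bsub>M\<^esub> x) ` carrier M = a_rcosets\<^bsub>M\<^esub> H"
    by (auto simp: A_RCOSETS_def RCOSETS_def a_r_coset_def)
  have zero: "H +>\<^bsub>M\<^esub> \<zero>\<^bsub>M\<^esub> = H" using sub by (rule M.a_coset_add_zero)
  show ?thesis
    unfolding module_epi_def quotient_module_def module.simps ring.simps monoid.simps partial_object.simps
  proof (intro conjI ballI image zero)
    fix x y assume "x \<in> carrier M" "y \<in> carrier M"
    then show "H +>\<^bsub>M\<^esub> (x \<oplus>\<^bsub>M\<^esub> y) = (H +>\<^bsub>M\<^esub> x) <+>\<^bsub>M\<^esub> (H +>\<^bsub>M\<^esub> y)"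
      by (rule a_rcos_sum[symmetric])
  next
    fix a x assume "a \<in> carrier R" "x \<in> carrier M"
    then show "H +>\<^bsub>M\<^esub> (a \<odot>\<^bsub>M\<^esub> x) = (\<Union>y\<in>H +>\<^bsub>M\<^esub> x. H +>\<^bsub>M\<^esub> (a \<odot>\<^bsub>M\<^esub> y))"
      by (rule smult)
  qed
qed

lemma quotient_module_zero_iff:
  assumes M: "module R M" and H: "submodule H R M" and x: "x \<in> carrier M"
  shows "H +>\<^bsub>M\<^esub> x = \<zero>\<^bsub>quotient_module M H\<^esub> \<longleftrightarrow> x \<in> H"
proof -
  interpret module R M by fact
  show ?thesis
    using x submodule.axioms(1)[OF H] M.a_coset_join1 M.a_coset_join2
    by (auto simp: quotient_module_def)
qed

text \<open>The form in which the comparison of kernels is applied: the quotient map itself need not be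
  described, only when an element of the covering module lands in \<open>H\<close>.\<close>

lemma isomorphic_modules_quotient:
  assumes M: "module R M" and f: "module_epi R M N f" and g: "module_epi R M B g"
    and H: "submodule H R B"
    and ker: "\<And>x. x \<in> carrier M \<Longrightarrow> f x = \<zero>\<^bsub>N\<^esub> \<longleftrightarrow> g x \<in> H"
  shows "isomorphic_modules R N (quotient_module B H)"
proof -
  have B: "module R B" by (rule module_epi_module[OF M g])
  show ?thesis
    by (rule isomorphic_modules_if_same_kernel[OF M f
          module_epi_compose[OF g module_epi_quotient[OF B H]]])
      (simp add: ker quotient_module_zero_iff[OF B H] module_epiD(5)[OF g])
qed


section \<open>Direct sums of cyclic modules\<close>

lemma (in cring) module_regular_module: "module R (regular_module R)"
proof (rule moduleI)
  show "abelian_group (regular_module R)"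
  proof (rule abelian_groupI)
    fix x assume x: "x \<in> carrier (regular_module R)"
    show "\<exists>y\<in>carrier (regular_module R).
        y \<oplus>\<^bsub>regular_module R\<^esub> x = \<zero>\<^bsub>regular_module R\<^esub>"
      using x by (intro bexI[of _ "\<ominus> x"]) (simp_all add: regular_module_def l_neg)
  qed (simp_all add: regular_module_def a_ac)
qed (simp_all add: regular_module_def cring_axioms l_distr r_distr m_assoc)

lemma module_direct_sum:
  assumes R: "cring R" and M: "\<And>i. i \<in> I \<Longrightarrow> module R (M i)"
  shows "module R (direct_sum I M)"
proof (rule moduleI)
  note ab = module.axioms(2)[OF M]
  note mon = abelian_group.axioms(1)[OF ab]
  show "cring R" by fact
  show "abelian_group (direct_sum I M)"
  proof (rule abelian_groupI)
    fix x assume x: "x \<in> carrier (direct_sum I M)"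
    have "(\<lambda>i\<in>I. \<ominus>\<^bsub>M i\<^esub> x i) \<in> carrier (direct_sum I M)"
      using x by (auto simp: direct_sum_def intro!: abelian_group.a_inv_closed[OF ab])
    moreover have "(\<lambda>i\<in>I. \<ominus>\<^bsub>M i\<^esub> x i) \<oplus>\<^bsub>direct_sum I M\<^esub> x = \<zero>\<^bsub>direct_sum I M\<^esub>"
      using x by (auto simp: direct_sum_def intro!: restrict_ext abelian_group.l_neg[OF ab])
    ultimately show "\<exists>y\<in>carrier (direct_sum I M).
        y \<oplus>\<^bsub>direct_sum I M\<^esub> x = \<zero>\<^bsub>direct_sum I M\<^esub>" by blast
  next
    fix x assume x: "x \<in> carrier (direct_sum I M)"
    show "\<zero>\<^bsub>direct_sum I M\<^esub> \<oplus>\<^bsub>direct_sum I M\<^esub> x = x"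
      using x by (intro extensionalityI[of _ I])
        (auto simp: direct_sum_def abelian_monoid.l_zero[OF mon] PiE_iff)
  next
    fix x y assume "x \<in> carrier (direct_sum I M)" "y \<in> carrier (direct_sum I M)"
    then show "x \<oplus>\<^bsub>direct_sum I M\<^esub> y = y \<oplus>\<^bsub>direct_sum I M\<^esub> x"
      by (auto simp: direct_sum_def intro!: restrict_ext abelian_monoid.a_comm[OF mon])
  next
    fix x y z assume "x \<in> carrier (direct_sum I M)" "y \<in> carrier (direct_sum I M)"
      "z \<in> carrier (direct_sum I M)"
    then show "x \<oplus>\<^bsub>direct_sum I M\<^esub> y \<oplus>\<^bsub>direct_sum I M\<^esub> z =
        x \<oplus>\<^bsub>direct_sum I M\<^esub> (y \<oplus>\<^bsub>direct_sum I M\<^esub> z)"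
      by (auto simp: direct_sum_def intro!: restrict_ext abelian_monoid.a_assoc[OF mon])
  qed (auto simp: direct_sum_def intro!: abelian_monoid.a_closed[OF mon]
      abelian_monoid.zero_closed[OF mon])
next
  fix x assume x: "x \<in> carrier (direct_sum I M)"
  show "\<one>\<^bsub>R\<^esub> \<odot>\<^bsub>direct_sum I M\<^esub> x = x"
    using x by (intro extensionalityI[of _ I])
      (auto simp: direct_sum_def module.smult_one[OF M] PiE_iff)
qed (auto simp: direct_sum_def intro!: restrict_ext module.smult_closed[OF M]
    module.smult_l_distr[OF M] module.smult_r_distr[OF M] module.smult_assoc1[OF M])



lemma module_epi_direct_sum:
  assumes f: "\<And>i. i \<in> I \<Longrightarrow> module_epi R (M i) (N i) (f i)"
  shows "module_epi R (direct_sum I M) (direct_sum I N) (\<lambda>v. \<lambda>i\<in>I. f i (v i))"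
proof -
  note fD = module_epiD[OF f]
  have "(\<lambda>v. \<lambda>i\<in>I. f i (v i)) ` (\<Pi>\<^sub>E i\<in>I. carrier (M i)) = (\<Pi>\<^sub>E i\<in>I. carrier (N i))" (is "?L = ?R")
  proof
    show "?L \<subseteq> ?R" by (auto intro!: fD(5))
    show "?R \<subseteq> ?L"
    proof
      fix w assume w: "w \<in> ?R"
      have "\<forall>i\<in>I. \<exists>x\<in>carrier (M i). w i = f i x"
        using w fD(1) PiE_mem by blast
      then obtain v where v: "\<And>i. i \<in> I \<Longrightarrow> v i \<in> carrier (M i) \<and> w i = f i (v i)"
        by metis
      have "w = (\<lambda>i\<in>I. f i (restrict v I i))"
        using w v by (intro extensionalityI[of _ I]) (auto simp: PiE_iff)
      moreover have "restrict v I \<in> (\<Pi>\<^sub>E i\<in>I. carrier (M i))" using v by simp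
      ultimately show "w \<in> ?L" by (rule image_eqI)
    qed
  qed
  moreover have "x i \<in> carrier (M i)" if "x \<in> (\<Pi>\<^sub>E i\<in>I. carrier (M i))" "i \<in> I" for x i
    using that by auto
  ultimately show ?thesis
    unfolding module_epi_def direct_sum_def
    by (auto simp: fD(2-4) simp del: PiE_iff intro!: restrict_ext)
qed

text \<open>A module that covers both \<open>B\<close> and the expected quotient of \<open>B\<close>, so that linear maps can be
  given by coordinates in \<open>R\<close>, with no representatives of cosets to choose.\<close>

definition free_module :: "('a, 'r) ring_scheme \<Rightarrow> 'i set \<Rightarrow> ('a, 'i \<Rightarrow> 'a) module" where
  "free_module R I = direct_sum I (\<lambda>_. regular_module R)"

lemma free_module_simps:
  "carrier (free_module R I) = (I \<rightarrow>\<^sub>E carrier R)"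
  "\<zero>\<^bsub>free_module R I\<^esub> = (\<lambda>i\<in>I. \<zero>\<^bsub>R\<^esub>)"
  "v \<oplus>\<^bsub>free_module R I\<^esub> w = (\<lambda>i\<in>I. v i \<oplus>\<^bsub>R\<^esub> w i)"
  "a \<odot>\<^bsub>free_module R I\<^esub> v = (\<lambda>i\<in>I. a \<otimes>\<^bsub>R\<^esub> v i)"
  by (simp_all add: free_module_def direct_sum_def regular_module_def)

lemma (in cring) module_free_module: "module R (free_module R I)"
  unfolding free_module_def by (intro module_direct_sum cring_axioms module_regular_module)

lemma (in cring) submodule_regular_module:
  assumes "ideal J R"
  shows "submodule J R (regular_module R)"
proof -
  interpret ideal J R by fact
  have neg: "\<ominus>\<^bsub>regular_module R\<^esub> x = \<ominus> x" if "x \<in> carrier R" for x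
  proof -
    interpret M: module R "regular_module R" by (rule module_regular_module)
    show ?thesis
      using M.M.minus_equality[of "\<ominus> x" x] that by (simp add: regular_module_def l_neg)
  qed
  show ?thesis
  proof (rule module.submoduleI[OF module_regular_module])
    fix x assume "x \<in> J"
    then show "\<ominus>\<^bsub>regular_module R\<^esub> x \<in> J" using neg[of x] Icarr by simp
  qed (use a_subset I_l_closed in \<open>simp_all add: regular_module_def\<close>)
qed

definition cyclic_sum ::
  "('a, 'r) ring_scheme \<Rightarrow> 'a \<Rightarrow> 'i set \<Rightarrow> ('i \<Rightarrow> nat) \<Rightarrow> ('a, 'i \<Rightarrow> 'a set) module" where
  "cyclic_sum R p I k =
     direct_sum I (\<lambda>i. quotient_module (regular_module R) (PIdl\<^bsub>R\<^esub> (p [^]\<^bsub>R\<^esub> k i)))"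

lemma partition_module_eq_cyclic_sum: "partition_module R p \<alpha> = cyclic_sum R p {i. \<alpha> i \<noteq> 0} \<alpha>"
  by (simp add: partition_module_def cyclic_sum_def)

definition residue ::
  "('a, 'r) ring_scheme \<Rightarrow> 'a \<Rightarrow> 'i set \<Rightarrow> ('i \<Rightarrow> nat) \<Rightarrow> ('i \<Rightarrow> 'a) \<Rightarrow> 'i \<Rightarrow> 'a set" where
  "residue R p I k v =
     (\<lambda>i\<in>I. PIdl\<^bsub>R\<^esub> (p [^]\<^bsub>R\<^esub> k i) +>\<^bsub>regular_module R\<^esub> v i)"

lemma residue_restrict [simp]: "residue R p I k (restrict v I) = residue R p I k v"
  by (auto simp: residue_def intro!: restrict_ext)

lemma residue_cong: "(\<And>i. i \<in> I \<Longrightarrow> v i = w i) \<Longrightarrow> residue R p I k v = residue R p I k w"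
  by (auto simp: residue_def intro!: restrict_ext)

text \<open>A nonzero generator of a maximal ideal. The last assumption says that \<open>R/(p)\<close> is a field; it
  makes the factors of the composition series simple.\<close>

locale maximal_element = domain R for R (structure) +
  fixes p
  assumes p_closed [simp]: "p \<in> carrier R"
    and p_nonzero: "p \<noteq> \<zero>"
    and one_notin_PIdl: "\<one> \<notin> PIdl p"
    and inverse_mod_p: "u \<in> carrier R \<Longrightarrow> u \<notin> PIdl p \<Longrightarrow> \<exists>b\<in>carrier R. \<one> \<ominus> b \<otimes> u \<in> PIdl p"
begin

abbreviation pow_ideal :: "nat \<Rightarrow> 'a set" where "pow_ideal k \<equiv> PIdl (p [^] k)"

lemma pow_ideal_ideal: "ideal (pow_ideal k) R"
  by (simp add: cgenideal_ideal)

lemma pow_ideal_closed: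
  "\<zero> \<in> pow_ideal k"
  "x \<in> pow_ideal k \<Longrightarrow> y \<in> pow_ideal k \<Longrightarrow> x \<oplus> y \<in> pow_ideal k"
  "x \<in> pow_ideal k \<Longrightarrow> y \<in> pow_ideal k \<Longrightarrow> x \<ominus> y \<in> pow_ideal k"
  "x \<in> pow_ideal k \<Longrightarrow> a \<in> carrier R \<Longrightarrow> a \<otimes> x \<in> pow_ideal k"
proof -
  interpret ideal "pow_ideal k" R by (rule pow_ideal_ideal)
  show "\<zero> \<in> pow_ideal k"
    "x \<in> pow_ideal k \<Longrightarrow> y \<in> pow_ideal k \<Longrightarrow> x \<oplus> y \<in> pow_ideal k"
    "x \<in> pow_ideal k \<Longrightarrow> y \<in> pow_ideal k \<Longrightarrow> x \<ominus> y \<in> pow_ideal k"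
    "x \<in> pow_ideal k \<Longrightarrow> a \<in> carrier R \<Longrightarrow> a \<otimes> x \<in> pow_ideal k"
    by (auto simp: a_minus_def I_l_closed)
qed

lemma pow_ideal_iff: "x \<in> pow_ideal k \<longleftrightarrow> (\<exists>u\<in>carrier R. x = p [^] k \<otimes> u)"
  unfolding cgenideal_def using m_comm by auto

lemma pow_mult_in_pow_ideal:
  assumes "u \<in> carrier R" "k \<le> j"
  shows "p [^] j \<otimes> u \<in> pow_ideal k"
proof -
  have "p [^] j \<otimes> u = p [^] k \<otimes> (p [^] (j - k) \<otimes> u)"
    using assms by (simp add: nat_pow_mult flip: m_assoc)
  then show ?thesis using assms by (auto simp: pow_ideal_iff)
qed

lemma pow_ideal_antimono: "k \<le> j \<Longrightarrow> x \<in> pow_ideal j \<Longrightarrow> x \<in> pow_ideal k"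
  using pow_mult_in_pow_ideal by (auto simp: pow_ideal_iff[of _ j])

lemma pow_mult_pow_ideal:
  assumes "x \<in> pow_ideal k"
  shows "p [^] j \<otimes> x \<in> pow_ideal (j + k)"
proof -
  obtain u where "u \<in> carrier R" "x = p [^] k \<otimes> u" using assms by (auto simp: pow_ideal_iff)
  then have "p [^] j \<otimes> x = p [^] (j + k) \<otimes> u" by (simp add: nat_pow_mult flip: m_assoc)
  then show ?thesis using \<open>u \<in> carrier R\<close> by (auto simp: pow_ideal_iff)
qed

lemma pow_notin_pow_ideal:
  assumes "j < k"
  shows "p [^] j \<notin> pow_ideal k"
proof
  assume "p [^] j \<in> pow_ideal k"
  then have "p [^] j \<in> pow_ideal (Suc j)" using assms pow_ideal_antimono[of "Suc j" k] by simp
  then obtain u where u: "u \<in> carrier R" "p [^] j = p [^] Suc j \<otimes> u"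
    unfolding pow_ideal_iff by blast
  have "p [^] j \<otimes> \<one> = p [^] j \<otimes> (p \<otimes> u)" using u by (simp add: m_assoc)
  moreover have "p [^] j \<noteq> \<zero>" using p_nonzero by (induction j) (auto simp: integral_iff)
  ultimately have "\<one> = p \<otimes> u" 
    using u(1) m_lcancel[of "p [^] j" \<one> "p \<otimes> u"] by simp
  then have "\<one> = u \<otimes> p" using u(1) m_comm[of p u] by simp
  then have "\<one> \<in> PIdl p" using u(1) unfolding cgenideal_def by blast
  then show False using one_notin_PIdl by simp
qed

lemma module_epi_residue: "module_epi R (free_module R I) (cyclic_sum R p I k) (residue R p I k)"
proof -
  have "module_epi R (free_module R I) (cyclic_sum R p I k)
      (\<lambda>v. \<lambda>i\<in>I. pow_ideal (k i) +>\<^bsub>regular_module R\<^esub> v i)"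
    unfolding free_module_def cyclic_sum_def
    by (intro module_epi_direct_sum module_epi_quotient module_regular_module
        submodule_regular_module pow_ideal_ideal)
  then show ?thesis by (simp add: residue_def[abs_def])
qed

lemma module_cyclic_sum: "module R (cyclic_sum R p I k)"
  by (rule module_epi_module[OF module_free_module module_epi_residue])

lemma carrier_cyclic_sum: "carrier (cyclic_sum R p I k) = residue R p I k ` (I \<rightarrow> carrier R)"
proof -
  have "residue R p I k v \<in> residue R p I k ` (I \<rightarrow>\<^sub>E carrier R)" if "v \<in> I \<rightarrow> carrier R" for v
    using that by (intro image_eqI[of _ _ "restrict v I"]) auto
  then have "residue R p I k ` (I \<rightarrow> carrier R) = residue R p I k ` (I \<rightarrow>\<^sub>E carrier R)"
    by (auto simp: PiE_def)
  then show ?thesis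
    using module_epiD(1)[OF module_epi_residue, of I k] by (simp add: free_module_simps)
qed

lemma residue_add:
  assumes "v \<in> I \<rightarrow> carrier R" "w \<in> I \<rightarrow> carrier R"
  shows "residue R p I k v \<oplus>\<^bsub>cyclic_sum R p I k\<^esub> residue R p I k w = residue R p I k (\<lambda>i. v i \<oplus> w i)"
proof -
  have "(\<lambda>i\<in>I. restrict v I i \<oplus> restrict w I i) = (\<lambda>i\<in>I. v i \<oplus> w i)"
    by (rule restrict_ext) simp
  then show ?thesis
    using module_epiD(3)[OF module_epi_residue, of "restrict v I" I "restrict w I" k] assms
    by (simp add: free_module_simps Pi_iff)
qed

lemma residue_smult:
  assumes "a \<in> carrier R" "v \<in> I \<rightarrow> carrier R"
  shows "a \<odot>\<^bsub>cyclic_sum R p I k\<^esub> residue R p I k v = residue R p I k (\<lambda>i. a \<otimes> v i)"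
proof -
  have "(\<lambda>i\<in>I. a \<otimes> restrict v I i) = (\<lambda>i\<in>I. a \<otimes> v i)"
    by (rule restrict_ext) simp
  then show ?thesis
    using module_epiD(4)[OF module_epi_residue, of a "restrict v I" I k] assms
    by (simp add: free_module_simps Pi_iff)
qed

lemma residue_zero_iff:
  assumes "v \<in> I \<rightarrow> carrier R"
  shows "residue R p I k v = \<zero>\<^bsub>cyclic_sum R p I k\<^esub> \<longleftrightarrow> (\<forall>i\<in>I. v i \<in> pow_ideal (k i))"
proof -
  have "pow_ideal (k i) +>\<^bsub>regular_module R\<^esub> v i
        = \<zero>\<^bsub>quotient_module (regular_module R) (pow_ideal (k i))\<^esub>
      \<longleftrightarrow> v i \<in> pow_ideal (k i)" if "i \<in> I" for i
  proof (rule quotient_module_zero_iff[OF module_regular_module])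
    show "submodule (pow_ideal (k i)) R (regular_module R)"
      by (intro submodule_regular_module pow_ideal_ideal)
    show "v i \<in> carrier (regular_module R)" using assms that by (auto simp: regular_module_def)
  qed
  then show ?thesis
    by (auto simp: residue_def cyclic_sum_def direct_sum_def fun_eq_iff restrict_def)
qed

lemma residue_eq_iff:
  assumes "v \<in> I \<rightarrow> carrier R" "w \<in> I \<rightarrow> carrier R"
  shows "residue R p I k v = residue R p I k w \<longleftrightarrow> (\<forall>i\<in>I. v i \<ominus> w i \<in> pow_ideal (k i))"
proof -
  interpret F: module R "free_module R I" by (rule module_free_module)
  let ?v = "restrict v I" and ?w = "restrict w I"
  have neg: "\<ominus>\<^bsub>free_module R I\<^esub> ?w = (\<lambda>i\<in>I. \<ominus> w i)"
    using assms
    by (intro F.M.minus_equality) (auto simp: free_module_simps intro!: restrict_ext l_neg)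
  have "residue R p I k v = residue R p I k w \<longleftrightarrow>
      residue R p I k (?v \<ominus>\<^bsub>free_module R I\<^esub> ?w) = \<zero>\<^bsub>cyclic_sum R p I k\<^esub>"
    using module_epi_eq_iff[OF module_free_module module_epi_residue, of ?v I ?w k] assms
    by (auto simp: free_module_simps)
  also have "residue R p I k (?v \<ominus>\<^bsub>free_module R I\<^esub> ?w) = residue R p I k (\<lambda>i. v i \<ominus> w i)"
    by (auto simp: a_minus_def neg free_module_simps intro!: residue_cong)
  finally show ?thesis
    using assms by (subst (asm) residue_zero_iff) auto
qed

end



section \<open>Composition series\<close>

text \<open>A composition series of the last submodule in the list, which need not be all of \<open>M\<close>, so that
  a series can be built up one submodule at a time.\<close>

definition composition_chain ::
  "('a, 'r) ring_scheme \<Rightarrow> ('a, 'm) module \<Rightarrow> 'm set list \<Rightarrow> bool" where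
  "composition_chain R M Hs \<longleftrightarrow>
     Hs \<noteq> [] \<and> hd Hs = {\<zero>\<^bsub>M\<^esub>} \<and> (\<forall>H\<in>set Hs. submodule H R M) \<and>
     (\<forall>i. Suc i < length Hs \<longrightarrow> Hs ! i \<subset> Hs ! Suc i \<and>
        \<not> (\<exists>K. submodule K R M \<and> Hs ! i \<subset> K \<and> K \<subset> Hs ! Suc i))"

lemma composition_chain_snoc:
  assumes Hs: "composition_chain R M Hs" and H: "submodule H R M" "last Hs \<subset> H"
    and between: "\<And>K. submodule K R M \<Longrightarrow> last Hs \<subset> K \<Longrightarrow> K \<subseteq> H \<Longrightarrow> K = H"
  shows "composition_chain R M (Hs @ [H])"
proof -
  have ne: "Hs \<noteq> []" using Hs by (simp add: composition_chain_def)
  have "(Hs @ [H]) ! i \<subset> (Hs @ [H]) ! Suc i \<and>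
      \<not> (\<exists>K. submodule K R M \<and> (Hs @ [H]) ! i \<subset> K \<and> K \<subset> (Hs @ [H]) ! Suc i)"
    if "Suc i < length (Hs @ [H])" for i
  proof (cases "Suc i < length Hs")
    case True
    then show ?thesis using Hs by (simp add: composition_chain_def nth_append)
  next
    case False
    then have "i = length Hs - 1" "Suc i = length Hs" using that by auto
    then have "(Hs @ [H]) ! i = last Hs" "(Hs @ [H]) ! Suc i = H"
      using ne by (simp_all add: nth_append last_conv_nth)
    then show ?thesis using H(2) between by auto
  qed
  then show ?thesis
    using Hs H(1) ne by (auto simp: composition_chain_def)
qed

context maximal_element
begin

text \<open>The submodule generated by the \<open>p\<^bsup>f i\<^esup> x\<^sub>i\<close>. Lowering one exponent at a time from \<open>f = k\<close>
  to \<open>f = 0\<close> passes from \<open>0\<close> to the whole module through a composition series.\<close>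

definition filtration :: "'i set \<Rightarrow> ('i \<Rightarrow> nat) \<Rightarrow> ('i \<Rightarrow> nat) \<Rightarrow> ('i \<Rightarrow> 'a set) set" where
  "filtration I k f = residue R p I k ` {v \<in> I \<rightarrow> carrier R. \<forall>i\<in>I. v i \<in> pow_ideal (f i)}"

lemma residue_in_filtration_iff:
  assumes v: "v \<in> I \<rightarrow> carrier R" and le: "\<And>i. i \<in> I \<Longrightarrow> f i \<le> k i"
  shows "residue R p I k v \<in> filtration I k f \<longleftrightarrow> (\<forall>i\<in>I. v i \<in> pow_ideal (f i))"
proof
  assume "residue R p I k v \<in> filtration I k f"
  then obtain w where w: "w \<in> I \<rightarrow> carrier R" "\<forall>i\<in>I. w i \<in> pow_ideal (f i)"
    "residue R p I k v = residue R p I k w" by (auto simp: filtration_def)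
  show "\<forall>i\<in>I. v i \<in> pow_ideal (f i)"
  proof
    fix i assume i: "i \<in> I"
    have "v i \<ominus> w i \<in> pow_ideal (k i)" using w v i by (simp add: residue_eq_iff)
    then have "v i \<ominus> w i \<in> pow_ideal (f i)" using le[OF i] pow_ideal_antimono by blast
    then have "(v i \<ominus> w i) \<oplus> w i \<in> pow_ideal (f i)" using w i pow_ideal_closed(2) by blast
    moreover have "(v i \<ominus> w i) \<oplus> w i = v i"
      using v w i by (simp add: Pi_iff a_minus_def a_assoc l_neg)
    ultimately show "v i \<in> pow_ideal (f i)" by simp
  qed
qed (use v in \<open>auto simp: filtration_def\<close>)

lemma submodule_filtration: "submodule (filtration I k f) R (cyclic_sum R p I k)"
proof -
  interpret M: module R "cyclic_sum R p I k" by (rule module_cyclic_sum)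
  have smult: "a \<odot>\<^bsub>cyclic_sum R p I k\<^esub> x \<in> filtration I k f"
    if a: "a \<in> carrier R" and x: "x \<in> filtration I k f" for a x
  proof -
    obtain v where v: "v \<in> I \<rightarrow> carrier R" "\<forall>i\<in>I. v i \<in> pow_ideal (f i)" "x = residue R p I k v"
      using x by (auto simp: filtration_def)
    have "(\<lambda>i. a \<otimes> v i) \<in> {v \<in> I \<rightarrow> carrier R. \<forall>i\<in>I. v i \<in> pow_ideal (f i)}"
      using a v pow_ideal_closed(4) by auto
    then show ?thesis using a v by (simp add: residue_smult filtration_def)
  qed
  show ?thesis
  proof (rule M.submoduleI)
    show sub: "filtration I k f \<subseteq> carrier (cyclic_sum R p I k)"
      by (auto simp: filtration_def carrier_cyclic_sum)
    show "\<zero>\<^bsub>cyclic_sum R p I k\<^esub> \<in> filtration I k f"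
      using residue_zero_iff[of "\<lambda>_. \<zero>" I k] pow_ideal_closed(1)
      by (auto simp: filtration_def intro!: image_eqI[of _ _ "\<lambda>_. \<zero>"])
    show "x \<oplus>\<^bsub>cyclic_sum R p I k\<^esub> y \<in> filtration I k f"
      if xy: "x \<in> filtration I k f" "y \<in> filtration I k f" for x y
    proof -
      obtain v w where v: "v \<in> I \<rightarrow> carrier R" "\<forall>i\<in>I. v i \<in> pow_ideal (f i)" "x = residue R p I k v"
        and w: "w \<in> I \<rightarrow> carrier R" "\<forall>i\<in>I. w i \<in> pow_ideal (f i)" "y = residue R p I k w"
        using xy by (auto simp: filtration_def)
      have "(\<lambda>i. v i \<oplus> w i) \<in> {v \<in> I \<rightarrow> carrier R. \<forall>i\<in>I. v i \<in> pow_ideal (f i)}"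
        using v w pow_ideal_closed(2) by auto
      then show ?thesis using v w by (simp add: residue_add filtration_def)
    qed
    show "\<ominus>\<^bsub>cyclic_sum R p I k\<^esub> x \<in> filtration I k f" if x: "x \<in> filtration I k f" for x
      using smult[of "\<ominus> \<one>" x] x sub by (auto simp: M.smult_l_minus)
  qed (rule smult)
qed

text \<open>A submodule strictly between the two pieces contains some \<open>v\<close> outside the smaller one, so
  \<open>v i = p\<^bsup>f i\<^esup> u\<close> and \<open>u\<close> invertible modulo \<open>p\<close>. Subtracting a multiple of \<open>v\<close> then takes any
  element of the larger piece into the smaller one.\<close>

lemma filtration_step_maximal:
  assumes i: "i \<in> I" and lt: "f i < k i" and le: "\<And>j. j \<in> I \<Longrightarrow> f j \<le> k j"
  defines "f' \<equiv> f(i := Suc (f i))"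
  shows "filtration I k f' \<subset> filtration I k f"
    and "submodule K R (cyclic_sum R p I k) \<Longrightarrow> filtration I k f' \<subset> K \<Longrightarrow>
      K \<subseteq> filtration I k f \<Longrightarrow> K = filtration I k f"
proof -
  have le': "f' j \<le> k j" if "j \<in> I" for j using lt le that by (simp add: f'_def)
  have "f j \<le> f' j" for j by (simp add: f'_def)
  then have "filtration I k f' \<subseteq> filtration I k f"
    unfolding filtration_def using pow_ideal_antimono by blast
  moreover have "residue R p I k (\<lambda>j. if j = i then p [^] f i else \<zero>)
      \<in> filtration I k f - filtration I k f'"
    using i lt le le' pow_notin_pow_ideal[of "f i" "Suc (f i)"] pow_ideal_closed(1)
      pow_mult_in_pow_ideal[of \<one> "f i" "f i"]
    by (subst Diff_iff, subst (1 2) residue_in_filtration_iff)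
      (auto simp: f'_def simp del: nat_pow_Suc)
  ultimately show "filtration I k f' \<subset> filtration I k f" by blast
next
  assume K: "submodule K R (cyclic_sum R p I k)" and sub: "filtration I k f' \<subset> K"
    and sup: "K \<subseteq> filtration I k f"
  have le': "f' j \<le> k j" if "j \<in> I" for j using lt le that by (simp add: f'_def)
  interpret K: submodule K R "cyclic_sum R p I k" by fact
  obtain x where x: "x \<in> K" "x \<notin> filtration I k f'" using sub by blast
  obtain v where v: "v \<in> I \<rightarrow> carrier R" "\<forall>j\<in>I. v j \<in> pow_ideal (f j)" "x = residue R p I k v"
    using x(1) sup by (auto simp: filtration_def)
  have "\<not> (\<forall>j\<in>I. v j \<in> pow_ideal (f' j))"
    using x(2) v residue_in_filtration_iff[of v I f' k] le' by blast
  then have vi: "v i \<notin> pow_ideal (Suc (f i))"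
    using v(2) unfolding f'_def by (metis fun_upd_apply)
  obtain u where u: "u \<in> carrier R" "v i = p [^] f i \<otimes> u"
    using v(2) i unfolding pow_ideal_iff by blast
  have "u \<notin> PIdl p"
  proof
    assume "u \<in> PIdl p"
    then have "u \<in> pow_ideal 1" by simp
    from pow_mult_pow_ideal[OF this, of "f i"] show False using vi u by simp
  qed
  then obtain b where b: "b \<in> carrier R" "\<one> \<ominus> b \<otimes> u \<in> pow_ideal 1"
    using inverse_mod_p[OF u(1)] by auto
  have "filtration I k f \<subseteq> K"
  proof
    fix y assume "y \<in> filtration I k f"
    then obtain w where w: "w \<in> I \<rightarrow> carrier R" "\<forall>j\<in>I. w j \<in> pow_ideal (f j)" "y = residue R p I k w"
      by (auto simp: filtration_def)
    obtain u' where u': "u' \<in> carrier R" "w i = p [^] f i \<otimes> u'"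
      using w(2) i unfolding pow_ideal_iff by blast
    define z where "z j = w j \<ominus> (u' \<otimes> b) \<otimes> v j" for j
    have z: "z \<in> I \<rightarrow> carrier R" using w(1) v(1) u'(1) b(1) by (auto simp: z_def Pi_iff intro!: minus_closed)
    have "z i = p [^] f i \<otimes> (u' \<otimes> (\<one> \<ominus> b \<otimes> u))"
      using u u' b by (simp add: z_def a_minus_def r_distr r_minus m_ac)
    moreover have "u' \<otimes> (\<one> \<ominus> b \<otimes> u) \<in> pow_ideal 1" using u' b pow_ideal_closed(4) by blast
    ultimately have "z i \<in> pow_ideal (Suc (f i))"
      using pow_mult_pow_ideal[of _ 1 "f i"] by simp
    moreover have "z j \<in> pow_ideal (f j)" if "j \<in> I" for j
      unfolding z_def using that w v u' b by (intro pow_ideal_closed(3,4)) auto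
    ultimately have "residue R p I k z \<in> filtration I k f'"
      using z le' by (subst residue_in_filtration_iff) (auto simp: f'_def simp del: nat_pow_Suc)
    then have "residue R p I k z \<in> K" using sub by blast
    moreover have "(u' \<otimes> b) \<odot>\<^bsub>cyclic_sum R p I k\<^esub> x \<in> K" using x u' b by auto
    ultimately have "residue R p I k z \<oplus>\<^bsub>cyclic_sum R p I k\<^esub>
        ((u' \<otimes> b) \<odot>\<^bsub>cyclic_sum R p I k\<^esub> x) \<in> K"
      using K.m_closed by simp
    also have "residue R p I k z \<oplus>\<^bsub>cyclic_sum R p I k\<^esub>
        ((u' \<otimes> b) \<odot>\<^bsub>cyclic_sum R p I k\<^esub> x) = residue R p I k (\<lambda>j. z j \<oplus> (u' \<otimes> b) \<otimes> v j)"
      unfolding v(3) using z v(1) u' b by (subst residue_smult; (subst residue_add)?) auto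
    also have "\<dots> = y"
      unfolding w(3) using w(1) v(1) u' b
      by (intro residue_cong) (simp add: z_def a_minus_def Pi_iff a_assoc l_neg)
    finally show "y \<in> K" .
  qed
  then show "K = filtration I k f" using sup by blast
qed

lemma finite_length_cyclic_sum:
  assumes "finite I"
  shows "finite_length R (cyclic_sum R p I k)"
proof -
  have "\<exists>Hs. composition_chain R (cyclic_sum R p I k) Hs \<and> last Hs = filtration I k f"
    if "\<And>i. i \<in> I \<Longrightarrow> f i \<le> k i" for f
    using that
  proof (induction "\<Sum>i\<in>I. k i - f i" arbitrary: f)
    case 0
    have eq: "f i = k i" if "i \<in> I" for i using 0 that \<open>finite I\<close> by fastforce
    have "filtration I k f = {\<zero>\<^bsub>cyclic_sum R p I k\<^esub>}"
    proof -
      have "x = \<zero>\<^bsub>cyclic_sum R p I k\<^esub>" if "x \<in> filtration I k f" for x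
        using that eq by (auto simp: filtration_def residue_zero_iff)
      moreover have "\<zero>\<^bsub>cyclic_sum R p I k\<^esub> \<in> filtration I k f"
        using subgroup.one_closed[OF submodule.axioms(1)[OF submodule_filtration, of I k f]]
        by simp
      ultimately show ?thesis by blast
    qed
    then show ?case
      using submodule_filtration[of I k f]
      by (intro exI[of _ "[filtration I k f]"]) (simp add: composition_chain_def)
  next
    case (Suc n)
    have "\<not> (\<forall>i\<in>I. k i \<le> f i)"
    proof
      assume "\<forall>i\<in>I. k i \<le> f i"
      then have "(\<Sum>i\<in>I. k i - f i) = 0" by (intro sum.neutral) simp
      then show False using Suc.hyps(2) by simp
    qed
    then obtain i where i: "i \<in> I" "f i < k i" by (meson leI)
    define f' where "f' = f(i := Suc (f i))"
    have "(\<Sum>j\<in>I. k j - f j) = Suc (\<Sum>j\<in>I. k j - f' j)"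
    proof -
      have "(\<Sum>j\<in>I - {i}. k j - f j) = (\<Sum>j\<in>I - {i}. k j - f' j)"
        by (rule sum.cong) (simp_all add: f'_def)
      then show ?thesis
        using sum.remove[OF \<open>finite I\<close> i(1), of "\<lambda>j. k j - f j"]
          sum.remove[OF \<open>finite I\<close> i(1), of "\<lambda>j. k j - f' j"] i(2)
        by (simp add: f'_def)
    qed
    moreover have "f' j \<le> k j" if "j \<in> I" for j using Suc.prems i that by (simp add: f'_def)
    ultimately have "\<exists>Hs. composition_chain R (cyclic_sum R p I k) Hs \<and> last Hs = filtration I k f'"
      using Suc.hyps(2) by (intro Suc.hyps(1)) simp_all
    then obtain Hs where Hs: "composition_chain R (cyclic_sum R p I k) Hs"
      "last Hs = filtration I k f'" by blast
    have "composition_chain R (cyclic_sum R p I k) (Hs @ [filtration I k f])"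
    proof (rule composition_chain_snoc[OF Hs(1) submodule_filtration])
      show "last Hs \<subset> filtration I k f"
        unfolding Hs(2) f'_def using i Suc.prems by (rule filtration_step_maximal)
      show "K = filtration I k f" if "submodule K R (cyclic_sum R p I k)" "last Hs \<subset> K"
        "K \<subseteq> filtration I k f" for K
        using filtration_step_maximal(2)[where f = f, OF i Suc.prems that(1)] that
        unfolding Hs(2) f'_def by blast
    qed
    then show ?case by (intro exI[of _ "Hs @ [filtration I k f]"]) simp
  qed
  from this[of "\<lambda>_. 0"] obtain Hs where
    Hs: "composition_chain R (cyclic_sum R p I k) Hs" "last Hs = filtration I k (\<lambda>_. 0)" by blast
  have "x \<in> pow_ideal 0" if "x \<in> carrier R" for x
    using pow_mult_in_pow_ideal[OF that, of 0 0] that by simp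
  then have "filtration I k (\<lambda>_. 0) = carrier (cyclic_sum R p I k)"
    unfolding filtration_def carrier_cyclic_sum by (intro arg_cong[of _ _ "image _"]) blast
  then show ?thesis
    using Hs unfolding finite_length_def composition_chain_def by (intro exI[of _ Hs]) simp
qed

end



section \<open>Submodules generated along chains of columns\<close>

text \<open>The combinatorial data of the construction. A column \<open>i\<close> has length \<open>\<beta> i\<close> and entry \<open>c i\<close>;
  \<open>pr\<close> leads to the column with the next smaller entry in the same chain, and \<open>\<rho>\<close> names the
  chain. The default \<open>c i = 0\<close> stands for a column without a box.\<close>

locale level_chains =
  fixes I :: "'i set" and \<beta> c :: "'i \<Rightarrow> nat" and pr :: "'i \<Rightarrow> 'i" and \<rho> :: "'i \<Rightarrow> 'j"
  assumes finite_I: "finite I"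
    and level_le: "i \<in> I \<Longrightarrow> c i \<le> \<beta> i"
    and pr_closed: "i \<in> I \<Longrightarrow> 2 \<le> c i \<Longrightarrow> pr i \<in> I"
    and level_pr: "i \<in> I \<Longrightarrow> 2 \<le> c i \<Longrightarrow> Suc (c (pr i)) = c i"
    and length_pr: "i \<in> I \<Longrightarrow> 2 \<le> c i \<Longrightarrow> \<beta> (pr i) < \<beta> i"
    and chain_pr: "i \<in> I \<Longrightarrow> 2 \<le> c i \<Longrightarrow> \<rho> (pr i) = \<rho> i"
    and chain_level_inj: "i \<in> I \<Longrightarrow> j \<in> I \<Longrightarrow> \<rho> i = \<rho> j \<Longrightarrow> c i = c j \<Longrightarrow> i = j"

locale chained_columns = maximal_element R p + level_chains I \<beta> c pr \<rho>
  for R (structure) and p and I :: "'i set" and \<beta> c pr and \<rho> :: "'i \<Rightarrow> 'j"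
begin

text \<open>The column lengths of the diagram of the boxes that are empty or have entry at most \<open>s\<close>.\<close>

definition shrunk :: "nat \<Rightarrow> 'i \<Rightarrow> nat" where
  "shrunk s i = (if s < c i then \<beta> i - 1 else \<beta> i)"

text \<open>The change of coordinates that clears \<open>p\<^sup>sa\<^sub>C\<close> from all columns with entry above \<open>s + 1\<close>.\<close>

definition reduced_coord :: "nat \<Rightarrow> ('i \<Rightarrow> 'a) \<Rightarrow> 'i \<Rightarrow> 'a" where
  "reduced_coord s v i =
     (if Suc s < c i then v i \<ominus> p [^] (\<beta> i - \<beta> (pr i) - 1) \<otimes> v (pr i) else v i)"

text \<open>The coordinates of the sum of the \<open>t\<^sub>C p\<^sup>s a\<^sub>C\<close> over the chains \<open>C\<close>. The subtraction does not
  truncate because \<open>c i \<le> \<beta> i\<close>.\<close>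

definition combination :: "nat \<Rightarrow> ('j \<Rightarrow> 'a) \<Rightarrow> 'i \<Rightarrow> 'a" where
  "combination s t i = p [^] (\<beta> i - c i + s) \<otimes> t (\<rho> i)"

lemma reduced_coord_closed:
  assumes "v \<in> I \<rightarrow> carrier R" "i \<in> I"
  shows "reduced_coord s v i \<in> carrier R"
  using assms pr_closed[of i] by (auto simp: reduced_coord_def Pi_iff intro!: minus_closed)

lemma combination_closed: "t \<in> UNIV \<rightarrow> carrier R \<Longrightarrow> combination s t \<in> I \<rightarrow> carrier R"
  by (simp add: combination_def Pi_iff)

text \<open>One inclusion of the kernel computation. For \<open>c i > s + 1\<close> the two contributions of
  \<open>p\<^sup>sa\<^sub>C\<close> cancel, and the error of \<open>v\<close> at the predecessor, divisible by \<open>p\<^bsup>\<beta> (pr i)\<^esup>\<close>, becomes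
  divisible by the required \<open>p\<^bsup>\<beta> i - 1\<^esup>\<close>. For \<open>c i \<le> s + 1\<close> the coordinate
  \<open>p\<^bsup>\<beta> i - c i + s\<^esup>\<close> is divisible by the required power already.\<close>

lemma reduced_coord_of_combination:
  assumes t: "t \<in> UNIV \<rightarrow> carrier R" and v: "v \<in> I \<rightarrow> carrier R"
    and eq: "\<And>i. i \<in> I \<Longrightarrow> v i \<ominus> combination s t i \<in> pow_ideal (\<beta> i)" and i: "i \<in> I"
  shows "reduced_coord s v i \<in> pow_ideal (shrunk s i)"
proof -
  have tc: "t j \<in> carrier R" for j using t by auto
  have mc: "combination s t j \<in> carrier R" for j using tc by (simp add: combination_def)
  have vc: "v j \<in> carrier R" if "j \<in> I" for j using v that by auto
  show ?thesis
  proof (cases "Suc s < c i")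
    case True
    define d where "d = \<beta> i - \<beta> (pr i) - 1"
    have j: "pr i \<in> I" "Suc (c (pr i)) = c i" "\<beta> (pr i) < \<beta> i" "\<rho> (pr i) = \<rho> i"
      using True i pr_closed level_pr length_pr chain_pr by simp_all
    have exps: "\<beta> i - c i + s = d + (\<beta> (pr i) - c (pr i) + s)" "d + \<beta> (pr i) = \<beta> i - 1"
      using j True level_le[OF i] level_le[OF j(1)] by (simp_all add: d_def)
    have "combination s t i = p [^] d \<otimes> combination s t (pr i)"
      unfolding combination_def exps(1) j(4) using tc by (simp add: m_assoc flip: nat_pow_mult)
    then have "reduced_coord s v i = (v i \<ominus> combination s t i) \<ominus> p [^] d \<otimes> (v (pr i) \<ominus> combination s t (pr i))"
      using True vc[OF i] vc[OF j(1)] mc[of "pr i"]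
      by (simp add: reduced_coord_def d_def a_minus_def r_distr r_minus minus_add a_ac r_neg r_neg1 r_neg2)
    moreover have "v i \<ominus> combination s t i \<in> pow_ideal (\<beta> i - 1)"
      using eq[OF i] pow_ideal_antimono[of "\<beta> i - 1" "\<beta> i"] by simp
    moreover have "p [^] d \<otimes> (v (pr i) \<ominus> combination s t (pr i)) \<in> pow_ideal (\<beta> i - 1)"
      using pow_mult_pow_ideal[OF eq[OF j(1)], of d] by (simp add: exps(2))
    ultimately show ?thesis using True pow_ideal_closed(3) by (simp add: shrunk_def)
  next
    case False
    have le: "shrunk s i \<le> \<beta> i" by (simp add: shrunk_def)
    have "shrunk s i \<le> \<beta> i - c i + s"
      using False level_le[OF i] by (auto simp: shrunk_def)
    then have "combination s t i \<in> pow_ideal (shrunk s i)"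
      unfolding combination_def using tc by (intro pow_mult_in_pow_ideal)
    moreover have "v i \<ominus> combination s t i \<in> pow_ideal (shrunk s i)"
      using pow_ideal_antimono[OF le] eq[OF i] by blast
    ultimately have "(v i \<ominus> combination s t i) \<oplus> combination s t i \<in> pow_ideal (shrunk s i)"
      using pow_ideal_closed(2) by blast
    moreover have "(v i \<ominus> combination s t i) \<oplus> combination s t i = v i"
      using vc[OF i] mc[of i] by (simp add: a_minus_def a_assoc l_neg)
    ultimately show ?thesis using False by (simp add: reduced_coord_def)
  qed
qed

text \<open>The converse inclusion. In each chain the coefficient of \<open>a\<^sub>C\<close> is found by successive
  approximation: if \<open>a\<close> is right on the columns with entry at most \<open>s + n\<close>, then adding a suitable
  \<open>p\<^sup>n z\<close> makes it right at the unique column with entry \<open>s + n + 1\<close>, and it remains right on the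
  earlier columns since there \<open>p\<^bsup>\<beta> k - c k + s\<^esup> p\<^sup>n\<close> is divisible by \<open>p\<^bsup>\<beta> k\<^esup>\<close>.\<close>

lemma combination_of_reduced_coord:
  assumes v: "v \<in> I \<rightarrow> carrier R"
    and reduced_coord: "\<And>i. i \<in> I \<Longrightarrow> reduced_coord s v i \<in> pow_ideal (shrunk s i)"
  shows "\<exists>t\<in>UNIV \<rightarrow> carrier R. \<forall>i\<in>I. v i \<ominus> combination s t i \<in> pow_ideal (\<beta> i)"
proof -
  have vc: "v i \<in> carrier R" if "i \<in> I" for i using v that by auto
  have chain: "\<exists>a\<in>carrier R. \<forall>i\<in>I. \<rho> i = j \<longrightarrow> c i \<le> s + n \<longrightarrow>
      v i \<ominus> p [^] (\<beta> i - c i + s) \<otimes> a \<in> pow_ideal (\<beta> i)" for j n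
  proof (induction n)
    case 0
    have "v i \<in> pow_ideal (\<beta> i)" if "i \<in> I" "c i \<le> s" for i
      using reduced_coord[OF that(1)] that(2) by (simp add: reduced_coord_def shrunk_def)
    then show ?case using vc by (intro bexI[of _ \<zero>]) (auto simp: a_minus_def)
  next
    case (Suc n)
    then obtain a where a: "a \<in> carrier R"
      "\<And>i. i \<in> I \<Longrightarrow> \<rho> i = j \<Longrightarrow> c i \<le> s + n \<Longrightarrow>
        v i \<ominus> p [^] (\<beta> i - c i + s) \<otimes> a \<in> pow_ideal (\<beta> i)" by auto
    show ?case
    proof (cases "\<exists>i\<in>I. \<rho> i = j \<and> c i = s + Suc n")
      case False
      then have "c i \<le> s + n" if "i \<in> I" "\<rho> i = j" "c i \<le> s + Suc n" for i
        using that by (metis add_Suc_right le_SucE)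
      then show ?thesis using a by blast
    next
      case True
      then obtain i where i: "i \<in> I" "\<rho> i = j" "c i = s + Suc n" by blast
      have len: "c i \<le> \<beta> i" by (rule level_le[OF i(1)])
      define e where "e = \<beta> i - c i + s"
      have e: "e + n = \<beta> i - 1" using len i(3) by (simp add: e_def)
      obtain x where x: "x \<in> carrier R" "reduced_coord s v i = p [^] (e + n) \<otimes> x"
      proof -
        have "shrunk s i = e + n" using i(3) by (simp add: shrunk_def e)
        then show thesis using reduced_coord[OF i(1)] that unfolding pow_ideal_iff by metis
      qed
      have "\<exists>z\<in>carrier R. v i = p [^] e \<otimes> (a \<oplus> p [^] n \<otimes> z)"
      proof (cases n)
        case 0
        \<comment> \<open>At the entry \<open>s + 1\<close> no condition comes from a predecessor, so \<open>a\<close> is simply replaced.\<close>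
        have "a \<oplus> (x \<ominus> a) = x"
          using a_lcomm[of a x "\<ominus> a"] x(1) a(1) by (simp add: a_minus_def r_neg)
        then have "v i = p [^] e \<otimes> (a \<oplus> p [^] n \<otimes> (x \<ominus> a))"
          using x a(1) i(3) 0 by (simp add: reduced_coord_def)
        then show ?thesis using x(1) a(1) by blast
      next
        case (Suc m)
        define d where "d = \<beta> i - \<beta> (pr i) - 1"
        have j: "pr i \<in> I" "Suc (c (pr i)) = c i" "\<beta> (pr i) < \<beta> i" "\<rho> (pr i) = \<rho> i"
          using Suc i pr_closed level_pr length_pr chain_pr by simp_all
        have exps: "d + (\<beta> (pr i) - c (pr i) + s) = e" "d + \<beta> (pr i) = e + n"
          using j i(3) len level_le[OF j(1)] by (simp_all add: d_def e_def)
        \<comment> \<open>The error \<open>y\<close> at the predecessor and the reduced coordinate \<open>x\<close> both enter the correction.\<close>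
        have "v (pr i) \<ominus> p [^] (\<beta> (pr i) - c (pr i) + s) \<otimes> a \<in> pow_ideal (\<beta> (pr i))"
          using a(2)[OF j(1)] j i by simp
        then obtain y where y: "y \<in> carrier R"
          "v (pr i) \<ominus> p [^] (\<beta> (pr i) - c (pr i) + s) \<otimes> a = p [^] \<beta> (pr i) \<otimes> y"
          unfolding pow_ideal_iff by blast
        have "v (pr i) = p [^] (\<beta> (pr i) - c (pr i) + s) \<otimes> a \<oplus> p [^] \<beta> (pr i) \<otimes> y"
          using y vc[OF j(1)] a(1) by (simp flip: y(2) add: a_minus_def a_ac r_neg1 r_neg2 r_neg)
        then have pv: "p [^] d \<otimes> v (pr i) = p [^] e \<otimes> a \<oplus> p [^] (e + n) \<otimes> y"
          using a(1) y(1) by (simp add: r_distr nat_pow_mult exps flip: m_assoc)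
        have "v i = reduced_coord s v i \<oplus> p [^] d \<otimes> v (pr i)"
          using vc[OF i(1)] vc[OF j(1)] Suc i(3)
          by (simp add: reduced_coord_def d_def a_minus_def a_assoc l_neg)
        also have "\<dots> = p [^] e \<otimes> (a \<oplus> p [^] n \<otimes> (x \<oplus> y))"
          unfolding pv x(2) using a(1) x(1) y(1) by (simp add: r_distr a_ac m_ac flip: nat_pow_mult)
        finally show ?thesis using x(1) y(1) by blast
      qed
      then obtain z where z: "z \<in> carrier R" "v i = p [^] e \<otimes> (a \<oplus> p [^] n \<otimes> z)" by blast
      define a' where "a' = a \<oplus> p [^] n \<otimes> z"
      have a': "a' \<in> carrier R" using a(1) z(1) by (simp add: a'_def)
      have "v k \<ominus> p [^] (\<beta> k - c k + s) \<otimes> a' \<in> pow_ideal (\<beta> k)"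
        if k: "k \<in> I" "\<rho> k = j" "c k \<le> s + Suc n" for k
      proof (cases "c k = s + Suc n")
        case True
        then have "k = i" using chain_level_inj[of k i] k i by simp
        then have "v k = p [^] (\<beta> k - c k + s) \<otimes> a'" using z(2) by (simp add: a'_def e_def)
        then show ?thesis using a' pow_ideal_closed(1) by (simp add: a_minus_def r_neg)
      next
        case False
        let ?e = "\<beta> k - c k + s"
        have *: "v k \<ominus> p [^] ?e \<otimes> a \<in> pow_ideal (\<beta> k)" using a(2) k False by simp
        have "p [^] (?e + n) \<otimes> z \<in> pow_ideal (\<beta> k)"
          using z(1) k False level_le[OF k(1)] by (intro pow_mult_in_pow_ideal) auto
        then have "(v k \<ominus> p [^] ?e \<otimes> a) \<ominus> p [^] (?e + n) \<otimes> z \<in> pow_ideal (\<beta> k)"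
          using * pow_ideal_closed(3) by blast
        also have "(v k \<ominus> p [^] ?e \<otimes> a) \<ominus> p [^] (?e + n) \<otimes> z = v k \<ominus> p [^] ?e \<otimes> a'"
          using vc[OF k(1)] a(1) z(1)
          by (simp add: a'_def a_minus_def r_distr minus_add a_assoc m_assoc flip: nat_pow_mult)
        finally show ?thesis .
      qed
      then show ?thesis using a' by blast
    qed
  qed
  have "\<exists>a\<in>carrier R. \<forall>i\<in>I. \<rho> i = j \<longrightarrow> v i \<ominus> p [^] (\<beta> i - c i + s) \<otimes> a \<in> pow_ideal (\<beta> i)" for j
  proof -
    have "c i \<le> s + (\<Sum>i\<in>I. c i)" if "i \<in> I" for i
      using member_le_sum[OF that _ finite_I, of c] by simp
    then show ?thesis using chain[of j "\<Sum>i\<in>I. c i"] by blast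
  qed
  then obtain t where "\<And>j. t j \<in> carrier R \<and>
      (\<forall>i\<in>I. \<rho> i = j \<longrightarrow> v i \<ominus> p [^] (\<beta> i - c i + s) \<otimes> t j \<in> pow_ideal (\<beta> i))"
    by metis
  then show ?thesis by (intro bexI[of _ t]) (auto simp: combination_def)
qed

text \<open>Columns that shrink to length \<open>0\<close> may be left out of \<open>J\<close>, as the summands of \<open>partition_module\<close>
  are the nonzero parts only. The map is onto because the change of coordinates is
  unitriangular with respect to the entry.\<close>

lemma module_epi_reduced_coord:
  assumes J: "J \<subseteq> I" "\<And>i. i \<in> I \<Longrightarrow> i \<notin> J \<Longrightarrow> shrunk s i = 0"
  shows "module_epi R (free_module R I) (cyclic_sum R p J (shrunk s))
    (\<lambda>v. residue R p J (shrunk s) (reduced_coord s v))"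
proof -
  let ?N = "cyclic_sum R p J (shrunk s)" and ?g = "\<lambda>v. residue R p J (shrunk s) (reduced_coord s v)"
  have cl: "reduced_coord s v \<in> J \<rightarrow> carrier R" if "v \<in> I \<rightarrow> carrier R" for v
    using reduced_coord_closed[OF that] J(1) by auto
  have prI: "pr i \<in> I" if "i \<in> J" "Suc s < c i" for i using that J(1) by (intro pr_closed) auto
  have restr: "reduced_coord s (restrict v I) i = reduced_coord s v i" if "i \<in> J" for v i
    using that J(1) prI[OF that] by (auto simp: reduced_coord_def)
  show ?thesis
    unfolding module_epi_def
  proof (intro conjI ballI)
    have "residue R p J (shrunk s) (reduced_coord s (\<lambda>i\<in>I. \<zero>)) = residue R p J (shrunk s) (\<lambda>_. \<zero>)"
      using prI J(1) by (intro residue_cong) (auto simp: reduced_coord_def a_minus_def)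
    also have "\<dots> = \<zero>\<^bsub>?N\<^esub>"
      using residue_zero_iff[of "\<lambda>_. \<zero>" J "shrunk s"] pow_ideal_closed(1) by simp
    finally show "?g \<zero>\<^bsub>free_module R I\<^esub> = \<zero>\<^bsub>?N\<^esub>" by (simp add: free_module_simps)
  next
    fix v w assume vw: "v \<in> carrier (free_module R I)" "w \<in> carrier (free_module R I)"
    then have v: "v \<in> I \<rightarrow> carrier R" and w: "w \<in> I \<rightarrow> carrier R"
      by (auto simp: free_module_simps)
    have "reduced_coord s (\<lambda>i\<in>I. v i \<oplus> w i) i = reduced_coord s v i \<oplus> reduced_coord s w i" if i: "i \<in> J" for i
    proof -
      have "v i \<in> carrier R" "w i \<in> carrier R"
        "Suc s < c i \<Longrightarrow> v (pr i) \<in> carrier R" "Suc s < c i \<Longrightarrow> w (pr i) \<in> carrier R"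
        using v w i J(1) prI by auto
      then show ?thesis
        using prI[OF i] J(1) i by (auto simp: reduced_coord_def a_minus_def r_distr minus_add a_ac)
    qed
    then have "?g (v \<oplus>\<^bsub>free_module R I\<^esub> w) = residue R p J (shrunk s) (\<lambda>i. reduced_coord s v i \<oplus> reduced_coord s w i)"
      by (auto simp: free_module_simps intro!: residue_cong)
    then show "?g (v \<oplus>\<^bsub>free_module R I\<^esub> w) = ?g v \<oplus>\<^bsub>?N\<^esub> ?g w"
      using cl[OF v] cl[OF w] by (simp add: residue_add)
  next
    fix a v assume a: "a \<in> carrier R" and "v \<in> carrier (free_module R I)"
    then have v: "v \<in> I \<rightarrow> carrier R" by (auto simp: free_module_simps)
    have "reduced_coord s (\<lambda>i\<in>I. a \<otimes> v i) i = a \<otimes> reduced_coord s v i" if i: "i \<in> J" for i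
    proof -
      have "v i \<in> carrier R" "Suc s < c i \<Longrightarrow> v (pr i) \<in> carrier R"
        using v i J(1) prI by auto
      then show ?thesis
        using prI[OF i] J(1) i a by (auto simp: reduced_coord_def a_minus_def r_distr r_minus m_ac)
    qed
    then have "?g (a \<odot>\<^bsub>free_module R I\<^esub> v) = residue R p J (shrunk s) (\<lambda>i. a \<otimes> reduced_coord s v i)"
      by (auto simp: free_module_simps intro!: residue_cong)
    then show "?g (a \<odot>\<^bsub>free_module R I\<^esub> v) = a \<odot>\<^bsub>?N\<^esub> ?g v"
      using cl[OF v] a by (simp add: residue_smult)
  next
    have "?g v \<in> carrier ?N" if "v \<in> carrier (free_module R I)" for v
      using cl[of v] that unfolding free_module_simps carrier_cyclic_sum by auto
    moreover have "x \<in> ?g ` carrier (free_module R I)" if x: "x \<in> carrier ?N" for x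
    proof -
      obtain y where y: "y \<in> J \<rightarrow> carrier R" "x = residue R p J (shrunk s) y"
        using x by (auto simp: carrier_cyclic_sum)
      define w where "w i = (if i \<in> J then y i else \<zero>)" for i
      have w: "w i \<in> carrier R" for i using y by (auto simp: w_def)
      \<comment> \<open>Back substitution: \<open>u m\<close> is the solution on the columns with entry \<open>m\<close>.\<close>
      define u where "u = rec_nat w (\<lambda>m u i. if s < m then
        w i \<oplus> p [^] (\<beta> i - \<beta> (pr i) - 1) \<otimes> u (pr i) else w i)"
      have u_simps: "u 0 = w" "u (Suc m) = (\<lambda>i. if s < m then
        w i \<oplus> p [^] (\<beta> i - \<beta> (pr i) - 1) \<otimes> u m (pr i) else w i)" for m
        unfolding u_def by simp_all
      have uc: "u m i \<in> carrier R" for m i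
        using w by (induction m arbitrary: i) (simp_all add: u_simps)
      define v where "v i = u (c i) i" for i
      have "reduced_coord s v i = w i" if i: "i \<in> I" for i
      proof (cases "Suc s < c i")
        case True
        have "v i = w i \<oplus> p [^] (\<beta> i - \<beta> (pr i) - 1) \<otimes> v (pr i)"
          unfolding v_def using True level_pr[OF i] u_simps(2)[of "c (pr i)"] by auto
        then show ?thesis
          using True w[of i] uc[of "c (pr i)" "pr i"]
          by (simp add: reduced_coord_def v_def a_minus_def a_assoc r_neg)
      next
        case False
        then show ?thesis by (cases "c i") (auto simp: reduced_coord_def v_def u_simps)
      qed
      then have "?g (restrict v I) = residue R p J (shrunk s) y"
        using restr J(1) by (intro residue_cong) (auto simp: w_def)
      moreover have "restrict v I \<in> carrier (free_module R I)"
        using uc by (simp add: free_module_simps v_def)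
      ultimately show ?thesis unfolding y(2) by (metis imageI)
    qed
    ultimately show "?g ` carrier (free_module R I) = carrier ?N" by blast
  qed
qed

text \<open>The submodule \<open>p\<^sup>sA\<close>; in particular \<open>A\<close> itself is \<open>chain_submodule 0\<close>.\<close>

definition chain_submodule :: "nat \<Rightarrow> ('i \<Rightarrow> 'a set) set" where
  "chain_submodule s = (\<lambda>t. residue R p I \<beta> (combination s t)) ` (UNIV \<rightarrow> carrier R)"

lemma residue_in_chain_submodule_iff:
  assumes v: "v \<in> I \<rightarrow> carrier R"
  shows "residue R p I \<beta> v \<in> chain_submodule s \<longleftrightarrow>
    (\<exists>t\<in>UNIV \<rightarrow> carrier R. \<forall>i\<in>I. v i \<ominus> combination s t i \<in> pow_ideal (\<beta> i))"
proof -
  have "residue R p I \<beta> v = residue R p I \<beta> (combination s t) \<longleftrightarrow>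
      (\<forall>i\<in>I. v i \<ominus> combination s t i \<in> pow_ideal (\<beta> i))" if "t \<in> UNIV \<rightarrow> carrier R" for t
    using that by (intro residue_eq_iff v combination_closed)
  then show ?thesis by (auto simp: chain_submodule_def)
qed

lemma submodule_chain_submodule: "submodule (chain_submodule s) R (cyclic_sum R p I \<beta>)"
proof -
  interpret M: module R "cyclic_sum R p I \<beta>" by (rule module_cyclic_sum)
  note mc = combination_closed[of _ s]
  have smult: "a \<odot>\<^bsub>cyclic_sum R p I \<beta>\<^esub> x \<in> chain_submodule s"
    if a: "a \<in> carrier R" and x: "x \<in> chain_submodule s" for a x
  proof -
    obtain t where t: "t \<in> UNIV \<rightarrow> carrier R" "x = residue R p I \<beta> (combination s t)"
      using x by (auto simp: chain_submodule_def)
    have "t j \<in> carrier R" for j using t by auto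
    then have "a \<odot>\<^bsub>cyclic_sum R p I \<beta>\<^esub> x = residue R p I \<beta> (combination s (\<lambda>j. a \<otimes> t j))"
      unfolding t(2) residue_smult[OF a mc[OF t(1)]]
      using a by (intro residue_cong) (simp add: combination_def m_ac)
    then show ?thesis using a t(1) by (auto simp: chain_submodule_def)
  qed
  show ?thesis
  proof (rule M.submoduleI)
    show sub: "chain_submodule s \<subseteq> carrier (cyclic_sum R p I \<beta>)"
      using mc by (auto simp: chain_submodule_def carrier_cyclic_sum)
    have "residue R p I \<beta> (combination s (\<lambda>_. \<zero>)) = \<zero>\<^bsub>cyclic_sum R p I \<beta>\<^esub>"
      by (subst residue_zero_iff) (auto simp: combination_def pow_ideal_closed(1))
    then show "\<zero>\<^bsub>cyclic_sum R p I \<beta>\<^esub> \<in> chain_submodule s"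
      by (auto simp: chain_submodule_def intro!: image_eqI[of _ _ "\<lambda>_. \<zero>"])
    show "x \<oplus>\<^bsub>cyclic_sum R p I \<beta>\<^esub> y \<in> chain_submodule s"
      if xy: "x \<in> chain_submodule s" "y \<in> chain_submodule s" for x y
    proof -
      obtain t u where t: "t \<in> UNIV \<rightarrow> carrier R" "x = residue R p I \<beta> (combination s t)"
        and u: "u \<in> UNIV \<rightarrow> carrier R" "y = residue R p I \<beta> (combination s u)"
        using xy by (auto simp: chain_submodule_def)
      have "t j \<in> carrier R" "u j \<in> carrier R" for j using t u by auto
      then have "x \<oplus>\<^bsub>cyclic_sum R p I \<beta>\<^esub> y = residue R p I \<beta> (combination s (\<lambda>j. t j \<oplus> u j))"
        unfolding t(2) u(2) residue_add[OF mc[OF t(1)] mc[OF u(1)]]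
        by (intro residue_cong) (simp add: combination_def r_distr)
      then show ?thesis using t(1) u(1) by (auto simp: chain_submodule_def)
    qed
    show "\<ominus>\<^bsub>cyclic_sum R p I \<beta>\<^esub> x \<in> chain_submodule s" if x: "x \<in> chain_submodule s" for x
      using smult[of "\<ominus> \<one>" x] x sub by (auto simp: M.smult_l_minus)
  qed (rule smult)
qed

lemma power_multiple_chain_submodule:
  "power_multiple R p (cyclic_sum R p I \<beta>) s (chain_submodule 0) = chain_submodule s"
proof -
  have "p [^] s \<odot>\<^bsub>cyclic_sum R p I \<beta>\<^esub> residue R p I \<beta> (combination 0 t) = residue R p I \<beta> (combination s t)"
    if t: "t \<in> UNIV \<rightarrow> carrier R" for t
  proof -
    have tc: "t j \<in> carrier R" for j using t by auto
    then have "p [^] s \<otimes> combination 0 t i = combination s t i" for i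
      using tc by (simp add: combination_def nat_pow_mult add.commute flip: m_assoc)
    then show ?thesis using combination_closed[OF t] by (simp add: residue_smult)
  qed
  then show ?thesis by (simp add: power_multiple_def chain_submodule_def image_image cong: image_cong)
qed

lemma quotient_by_power_multiple:
  assumes J: "J \<subseteq> I" "\<And>i. i \<in> I \<Longrightarrow> i \<notin> J \<Longrightarrow> shrunk s i = 0"
  shows "isomorphic_modules R (cyclic_sum R p J (shrunk s))
    (quotient_module (cyclic_sum R p I \<beta>)
      (power_multiple R p (cyclic_sum R p I \<beta>) s (chain_submodule 0)))"
  unfolding power_multiple_chain_submodule
proof (rule isomorphic_modules_quotient[OF module_free_module module_epi_reduced_coord[OF J]
      module_epi_residue submodule_chain_submodule])
  fix v assume "v \<in> carrier (free_module R I)"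
  then have v: "v \<in> I \<rightarrow> carrier R" by (auto simp: free_module_simps)
  have all: "x \<in> pow_ideal 0" if "x \<in> carrier R" for x
    using pow_mult_in_pow_ideal[OF that, of 0 0] that by simp
  have "residue R p J (shrunk s) (reduced_coord s v) = \<zero>\<^bsub>cyclic_sum R p J (shrunk s)\<^esub>
      \<longleftrightarrow> (\<forall>i\<in>J. reduced_coord s v i \<in> pow_ideal (shrunk s i))"
    using reduced_coord_closed[OF v] J(1) by (intro residue_zero_iff) auto
  also have "\<dots> \<longleftrightarrow> (\<forall>i\<in>I. reduced_coord s v i \<in> pow_ideal (shrunk s i))"
    using J all reduced_coord_closed[OF v] by (metis subsetD)
  also have "\<dots> \<longleftrightarrow> residue R p I \<beta> v \<in> chain_submodule s"
    unfolding residue_in_chain_submodule_iff[OF v]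
    using reduced_coord_of_combination[OF _ v] combination_of_reduced_coord[OF v] by blast
  finally show "residue R p J (shrunk s) (reduced_coord s v) = \<zero>\<^bsub>cyclic_sum R p J (shrunk s)\<^esub>
      \<longleftrightarrow> residue R p I \<beta> v \<in> chain_submodule s" .
qed

end



section \<open>Chains of columns in a tableau on a horizontal strip\<close>

text \<open>Hall's condition for the relation \<open>\<le>\<close> reduces to upper sets. The largest element of \<open>X\<close> may be
  sent to any \<open>y\<close> above it: for \<open>a\<close> at most this element both counts drop by one, and beyond it
  there is nothing left to match.\<close>

lemma injection_to_the_right:
  fixes X Y :: "nat set"
  assumes "finite X" "finite Y" "\<And>a. card {x \<in> X. a \<le> x} \<le> card {y \<in> Y. a \<le> y}"
  shows "\<exists>f. inj_on f X \<and> (\<forall>x\<in>X. f x \<in> Y \<and> x \<le> f x)"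
  using assms
proof (induction X arbitrary: Y rule: finite_linorder_max_induct)
  case empty
  then show ?case by simp
next
  case (insert b X)
  have "0 < card {x \<in> insert b X. b \<le> x}" using insert.hyps(1) by (auto simp: card_gt_0_iff)
  then have "0 < card {y \<in> Y. b \<le> y}" using insert.prems(2)[of b] by simp
  then obtain y where y: "y \<in> Y" "b \<le> y" by (auto simp: card_gt_0_iff)
  have "card {x \<in> X. a \<le> x} \<le> card {z \<in> Y - {y}. a \<le> z}" for a
  proof (cases "a \<le> b")
    case True
    have "{x \<in> insert b X. a \<le> x} = insert b {x \<in> X. a \<le> x}" using True by auto
    then have "card {x \<in> insert b X. a \<le> x} = Suc (card {x \<in> X. a \<le> x})"
      using insert.hyps by auto
    moreover have "{z \<in> Y. a \<le> z} = insert y {z \<in> Y - {y}. a \<le> z}" using True y by auto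
    then have "card {z \<in> Y. a \<le> z} = Suc (card {z \<in> Y - {y}. a \<le> z})"
      using insert.prems(1) by simp
    ultimately show ?thesis using insert.prems(2)[of a] by simp
  next
    case False
    then have "{x \<in> X. a \<le> x} = {}" using insert.hyps(2) by force
    then show ?thesis by (simp only: card.empty)
  qed
  then obtain f where f: "inj_on f X" "\<forall>x\<in>X. f x \<in> Y - {y} \<and> x \<le> f x"
    using insert.IH[of "Y - {y}"] insert.prems(1) by auto
  have b: "b \<notin> X" using insert.hyps(2) by auto
  have "inj_on (f(b := y)) (insert b X)"
    unfolding inj_on_def using f(1)[unfolded inj_on_def] f(2) b by auto
  moreover have "\<forall>x\<in>insert b X. (f(b := y)) x \<in> Y \<and> x \<le> (f(b := y)) x" using f b y by auto
  ultimately show ?case by blast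
qed

text \<open>The only box that column \<open>i\<close> of a horizontal strip can have lies in row \<open>\<gamma> i\<close>. The value \<open>0\<close>
  marks a column without a box, as tableau entries are positive.\<close>

definition entry :: "(nat \<Rightarrow> nat) \<Rightarrow> (nat \<Rightarrow> nat) \<Rightarrow> (nat \<times> nat \<Rightarrow> nat) \<Rightarrow> nat \<Rightarrow> nat" where
  "entry \<beta> \<gamma> T i = (if \<gamma> i < \<beta> i then T (\<gamma> i, i) else 0)"

locale LR_horizontal_strip =
  fixes \<alpha> \<beta> \<gamma> :: "nat \<Rightarrow> nat" and T :: "nat \<times> nat \<Rightarrow> nat"
  assumes \<alpha>: "is_partition \<alpha>" and \<beta>: "is_partition \<beta>" and \<gamma>: "is_partition \<gamma>"
    and LR: "LR_tableau \<alpha> \<beta> \<gamma> T" and strip: "horizontal_strip \<beta> \<gamma>"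
begin

abbreviation c :: "nat \<Rightarrow> nat" where "c \<equiv> entry \<beta> \<gamma> T"

lemma outer_le: "\<beta> i \<le> Suc (\<gamma> i)"
  using strip by (simp add: horizontal_strip_def)

lemma skew_diagram_strip: "(j, i) \<in> skew_diagram \<beta> \<gamma> \<longleftrightarrow> \<gamma> i < \<beta> i \<and> j = \<gamma> i"
  using outer_le[of i] by (auto simp: skew_diagram_def young_diagram_def)

lemma entry_pos_iff: "0 < c i \<longleftrightarrow> \<gamma> i < \<beta> i"
  using LR skew_diagram_strip[of "\<gamma> i" i] by (auto simp: LR_tableau_def entry_def)

lemma card_boxes_eq_card_columns:
  assumes "1 \<le> e"
  shows "card {(j, i) \<in> skew_diagram \<beta> \<gamma>. P i \<and> T (j, i) = e} = card {i. P i \<and> c i = e}"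
proof -
  have "bij_betw snd {(j, i) \<in> skew_diagram \<beta> \<gamma>. P i \<and> T (j, i) = e} {i. P i \<and> c i = e}"
  proof (rule bij_betw_byWitness[where f' = "\<lambda>i. (\<gamma> i, i)"])
    show "snd ` {(j, i) \<in> skew_diagram \<beta> \<gamma>. P i \<and> T (j, i) = e} \<subseteq> {i. P i \<and> c i = e}"
      by (auto simp: skew_diagram_strip entry_def)
    show "(\<lambda>i. (\<gamma> i, i)) ` {i. P i \<and> c i = e} \<subseteq> {(j, i) \<in> skew_diagram \<beta> \<gamma>. P i \<and> T (j, i) = e}"
      using assms by (auto simp: skew_diagram_strip entry_def split: if_splits)
  qed (auto simp: skew_diagram_strip)
  then show ?thesis by (rule bij_betw_same_card)
qed

lemma finite_entries: "1 \<le> e \<Longrightarrow> finite {i. c i = e}"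
  using \<beta> by (auto simp: is_partition_def entry_def elim!: rev_finite_subset split: if_splits)

lemma card_entries: "1 \<le> e \<Longrightarrow> card {i. c i = e} = transpose_part \<alpha> e"
  using card_boxes_eq_card_columns[of e "\<lambda>_. True"] LR
  by (simp add: LR_tableau_def case_prod_beta')

lemma finite_parts: "1 \<le> e \<Longrightarrow> finite {i. e \<le> \<alpha> i}"
  using \<alpha> by (auto simp: is_partition_def elim!: rev_finite_subset)

lemma entry_occurs_iff:
  assumes "1 \<le> e"
  shows "(\<exists>i. c i = e) \<longleftrightarrow> e \<le> \<alpha> 0"
proof -
  have "(\<exists>i. c i = e) \<longleftrightarrow> 0 < card {i. c i = e}"
    using finite_entries[OF assms] by (auto simp: card_gt_0_iff)
  also have "\<dots> \<longleftrightarrow> (\<exists>i. e \<le> \<alpha> i)"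
    using card_entries[OF assms] finite_parts[OF assms]
    by (auto simp: transpose_part_def card_gt_0_iff)
  also have "\<dots> \<longleftrightarrow> e \<le> \<alpha> 0"
    using \<alpha> by (auto simp: is_partition_def antimono_def intro: order_trans)
  finally show ?thesis .
qed

text \<open>Counting from column \<open>0\<close> on is not covered by the condition on the columns to the right of a
  given one; there the counts are parts of the transpose of \<open>\<alpha>\<close>, which decrease.\<close>

lemma lattice_condition:
  assumes "1 \<le> e"
  shows "card {i \<in> {i. c i = Suc e}. a \<le> i} \<le> card {i \<in> {i. c i = e}. a \<le> i}"
proof (cases a)
  case 0
  have "card {i. Suc e \<le> \<alpha> i} \<le> card {i. e \<le> \<alpha> i}"
    using finite_parts[OF assms] by (intro card_mono) auto
  then show ?thesis
    using 0 assms card_entries[of e] card_entries[of "Suc e"] by (simp add: transpose_part_def)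
next
  case (Suc b)
  have "card {(j, i) \<in> skew_diagram \<beta> \<gamma>. b < i \<and> T (j, i) = e + 1}
      \<le> card {(j, i) \<in> skew_diagram \<beta> \<gamma>. b < i \<and> T (j, i) = e}"
    using LR assms unfolding LR_tableau_def by blast
  then show ?thesis
    using Suc assms card_boxes_eq_card_columns[of e "\<lambda>i. b < i"]
      card_boxes_eq_card_columns[of "Suc e" "\<lambda>i. b < i"]
    by (simp add: Suc_le_eq conj_commute)
qed

text \<open>Columns of equal length have their boxes in the same row, where entries increase from left to
  right.\<close>

lemma predecessor_shorter:
  assumes "1 \<le> c j" "c j < c i" "i \<le> j"
  shows "\<beta> j < \<beta> i"
proof -
  have ij: "i < j" using assms by (metis le_eq_less_or_eq less_irrefl)
  have boxes: "\<gamma> i < \<beta> i" "\<gamma> j < \<beta> j" using assms entry_pos_iff[of i] entry_pos_iff[of j] by auto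
  have "\<beta> j \<le> \<beta> i" using \<beta> assms(3) by (simp add: is_partition_def antimono_def)
  moreover have "\<beta> j \<noteq> \<beta> i"
  proof
    assume "\<beta> j = \<beta> i"
    then have "\<gamma> j = \<gamma> i" using boxes outer_le[of i] outer_le[of j] by simp
    then have "(\<gamma> i, i) \<in> skew_diagram \<beta> \<gamma>" "(\<gamma> i, j) \<in> skew_diagram \<beta> \<gamma>"
      using boxes by (simp_all add: skew_diagram_strip)
    then have "T (\<gamma> i, i) \<le> T (\<gamma> i, j)" using LR ij unfolding LR_tableau_def by blast
    then show False using assms(2) boxes \<open>\<gamma> j = \<gamma> i\<close> by (simp add: entry_def)
  qed
  ultimately show ?thesis by simp
qed

lemma ex_predecessor:
  "\<exists>pr. (\<forall>i. 2 \<le> c i \<longrightarrow> Suc (c (pr i)) = c i \<and> \<beta> (pr i) < \<beta> i) \<and> inj_on pr {i. 2 \<le> c i}"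
proof -
  have "\<exists>f. inj_on f {i. c i = Suc e} \<and> (\<forall>i. c i = Suc e \<longrightarrow> c (f i) = e \<and> i \<le> f i)"
    if "1 \<le> e" for e
    using injection_to_the_right[OF finite_entries[of "Suc e"] finite_entries[OF that]
        lattice_condition[OF that]] by auto
  then have "\<forall>e. \<exists>f. 1 \<le> e \<longrightarrow>
      inj_on f {i. c i = Suc e} \<and> (\<forall>i. c i = Suc e \<longrightarrow> c (f i) = e \<and> i \<le> f i)"
    by blast
  from choice[OF this] obtain f where f: "\<And>e. 1 \<le> e \<Longrightarrow> inj_on (f e) {i. c i = Suc e}"
    "\<And>e i. 1 \<le> e \<Longrightarrow> c i = Suc e \<Longrightarrow> c (f e i) = e \<and> i \<le> f e i"
    by blast
  define pr where "pr i = f (c i - 1) i" for i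
  have pr: "Suc (c (pr i)) = c i" "i \<le> pr i" if "2 \<le> c i" for i
    using f(2)[of "c i - 1" i] that by (simp_all add: pr_def)
  have "\<beta> (pr i) < \<beta> i" if "2 \<le> c i" for i
    using pr[OF that] that by (intro predecessor_shorter) auto
  moreover have "inj_on pr {i. 2 \<le> c i}"
  proof (rule inj_onI)
    fix i j assume ij: "i \<in> {i. 2 \<le> c i}" "j \<in> {i. 2 \<le> c i}" "pr i = pr j"
    then have "c i = c j" using pr(1)[of i] pr(1)[of j] by simp
    then show "i = j"
      using inj_onD[OF f(1)[of "c i - 1"], of i j] ij by (simp add: pr_def)
  qed
  ultimately show ?thesis using pr by blast
qed

text \<open>A chain is named after its first column, reached from a column with entry \<open>e\<close> by \<open>e - 1\<close>
  steps. Injectivity of \<open>pr\<close> makes each column of a chain determined by its entry.\<close>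

lemma ex_level_chains:
  "\<exists>pr \<rho>. level_chains {i. \<beta> i \<noteq> 0} \<beta> c pr \<rho> \<and> (\<forall>i. \<beta> i \<noteq> 0 \<longrightarrow> \<beta> (\<rho> i) \<noteq> 0)"
proof -
  obtain pr where pr: "\<And>i. 2 \<le> c i \<Longrightarrow> Suc (c (pr i)) = c i"
    "\<And>i. 2 \<le> c i \<Longrightarrow> \<beta> (pr i) < \<beta> i" and inj: "inj_on pr {i. 2 \<le> c i}"
    using ex_predecessor by blast
  have pos: "\<beta> i \<noteq> 0" if "1 \<le> c i" for i using that entry_pos_iff[of i] by simp
  define \<rho> where "\<rho> i = (pr ^^ (c i - 1)) i" for i
  have \<rho>_base: "\<rho> i = i" if "c i \<le> 1" for i using that by (simp add: \<rho>_def)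
  have \<rho>_pr: "\<rho> (pr i) = \<rho> i" if "2 \<le> c i" for i
  proof -
    have "c i - 1 = Suc (c (pr i) - 1)" using pr(1)[OF that] that by simp
    then show ?thesis by (simp add: \<rho>_def funpow_swap1)
  qed
  have le: "c i \<le> \<beta> i" for i
  proof (induction "c i" arbitrary: i rule: less_induct)
    case less
    show ?case
    proof (cases "2 \<le> c i")
      case True
      then show ?thesis using less[of "pr i"] pr[OF True] by simp
    next
      case False
      then show ?thesis using pos[of i] by (cases "c i = 0") auto
    qed
  qed
  have uniq: "i = j" if "c i = m" "c j = m" "\<rho> i = \<rho> j" for m i j
    using that
  proof (induction m arbitrary: i j)
    case 0
    then show ?case using \<rho>_base[of i] \<rho>_base[of j] by simp
  next
    case (Suc m)
    show ?case
    proof (cases "m = 0")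
      case True
      then show ?thesis using Suc.prems \<rho>_base[of i] \<rho>_base[of j] by simp
    next
      case False
      then have ij: "2 \<le> c i" "2 \<le> c j" using Suc.prems by simp_all
      have "pr i = pr j"
      proof (rule Suc.IH)
        show "c (pr i) = m" "c (pr j) = m"
          using pr(1)[OF ij(1)] pr(1)[OF ij(2)] Suc.prems by simp_all
        show "\<rho> (pr i) = \<rho> (pr j)" using \<rho>_pr[OF ij(1)] \<rho>_pr[OF ij(2)] Suc.prems(3) by simp
      qed
      then show ?thesis using inj_onD[OF inj, of i j] ij by simp
    qed
  qed
  have root: "\<beta> (\<rho> i) \<noteq> 0" if "\<beta> i \<noteq> 0" for i
    using that
  proof (induction "c i" arbitrary: i rule: less_induct)
    case less
    show ?case
    proof (cases "2 \<le> c i")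
      case True
      then show ?thesis using less.hyps[of "pr i"] pr(1)[OF True] \<rho>_pr[OF True] pos[of "pr i"] by simp
    next
      case False
      then show ?thesis using less.prems \<rho>_base[of i] by simp
    qed
  qed
  have "level_chains {i. \<beta> i \<noteq> 0} \<beta> c pr \<rho>"
  proof
    show "finite {i. \<beta> i \<noteq> 0}" using \<beta> by (simp add: is_partition_def)
    show "i = j" if "\<rho> i = \<rho> j" "c i = c j" for i j
      by (rule uniq[OF refl that(2)[symmetric] that(1)])
    fix i
    show "c i \<le> \<beta> i" by (rule le)
    assume i: "2 \<le> c i"
    show "Suc (c (pr i)) = c i" "\<beta> (pr i) < \<beta> i" using pr i by blast+
    show "\<rho> (pr i) = \<rho> i" using i by (rule \<rho>_pr)
    show "pr i \<in> {i. \<beta> i \<noteq> 0}" using pos[of "pr i"] pr(1)[OF i] i by simp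
  qed
  then show ?thesis using root by (intro exI[of _ pr] exI[of _ \<rho>]) simp
qed

lemma tableau_partition_strip:
  "tableau_partition \<beta> \<gamma> T e i = (if e < c i then \<beta> i - 1 else \<beta> i)"
proof (cases "\<gamma> i < \<beta> i")
  case False
  then have "{j. j < \<beta> i \<and> (j < \<gamma> i \<or> T (j, i) \<le> e)} = {..<\<beta> i}" by auto
  then show ?thesis using False by (simp add: tableau_partition_def entry_def)
next
  case True
  then have b: "\<beta> i = Suc (\<gamma> i)" using outer_le[of i] by simp
  have "{j. j < \<beta> i \<and> (j < \<gamma> i \<or> T (j, i) \<le> e)} = (if e < c i then {..<\<gamma> i} else {..<\<beta> i})"
    using b by (auto simp: entry_def less_Suc_eq)
  then show ?thesis using b by (simp add: tableau_partition_def)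
qed

text \<open>Only columns \<open>i \<le> j\<close> of equal length with \<open>i\<close> shrinking and \<open>j\<close> not could violate
  monotonicity; column \<open>j\<close> must then have a box as well, with a smaller entry in the same row,
  against the row condition.\<close>

lemma is_partition_tableau_partition: "is_partition (tableau_partition \<beta> \<gamma> T e)"
proof -
  have "tableau_partition \<beta> \<gamma> T e j \<le> tableau_partition \<beta> \<gamma> T e i" if "i \<le> j" for i j
  proof -
    have le: "\<beta> j \<le> \<beta> i" "\<gamma> j \<le> \<gamma> i" using \<beta> \<gamma> that by (simp_all add: is_partition_def antimono_def)
    have "\<not> (e < c i \<and> \<not> e < c j \<and> \<beta> j = \<beta> i)"
    proof
      assume *: "e < c i \<and> \<not> e < c j \<and> \<beta> j = \<beta> i"
      then have "\<gamma> i < \<beta> i" using entry_pos_iff[of i] by simp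
      then have "\<gamma> j < \<beta> j" using * le by simp
      then have "0 < c j" by (simp add: entry_pos_iff)
      then show False using predecessor_shorter[of j i] * that by simp
    qed
    then show ?thesis using le by (auto simp: tableau_partition_strip)
  qed
  moreover have "{i. tableau_partition \<beta> \<gamma> T e i \<noteq> 0} \<subseteq> {i. \<beta> i \<noteq> 0}"
    by (auto simp: tableau_partition_strip)
  ultimately show ?thesis
    using \<beta> by (auto simp: is_partition_def antimono_def elim: rev_finite_subset)
qed

end



section \<open>The embedding attached to a tableau\<close>

lemma module_iso_regroup:
  assumes \<rho>: "\<rho> ` I \<subseteq> J"
  shows "(\<lambda>x. \<lambda>j\<in>J. \<lambda>i\<in>{i \<in> I. \<rho> i = j}. x i)
    \<in> module_iso R (direct_sum I M) (direct_sum J (\<lambda>j. direct_sum {i \<in> I. \<rho> i = j} M))"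
proof -
  let ?f = "\<lambda>x. \<lambda>j\<in>J. \<lambda>i\<in>{i \<in> I. \<rho> i = j}. x i"
  let ?g = "\<lambda>y. \<lambda>i\<in>I. y (\<rho> i) i"
  have \<rho>J: "\<rho> i \<in> J" if "i \<in> I" for i using \<rho> that by auto
  have bij: "bij_betw ?f (\<Pi>\<^sub>E i\<in>I. carrier (M i)) (\<Pi>\<^sub>E j\<in>J. \<Pi>\<^sub>E i\<in>{i \<in> I. \<rho> i = j}. carrier (M i))"
  proof (rule bij_betw_byWitness[where f' = ?g])
    show "\<forall>x\<in>\<Pi>\<^sub>E i\<in>I. carrier (M i). ?g (?f x) = x"
      by (auto intro!: extensionalityI[of _ I] simp: PiE_iff \<rho>J)
    show "\<forall>y\<in>\<Pi>\<^sub>E j\<in>J. \<Pi>\<^sub>E i\<in>{i \<in> I. \<rho> i = j}. carrier (M i). ?f (?g y) = y"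
    proof
      fix y assume y: "y \<in> (\<Pi>\<^sub>E j\<in>J. \<Pi>\<^sub>E i\<in>{i \<in> I. \<rho> i = j}. carrier (M i))"
      show "?f (?g y) = y"
      proof (rule extensionalityI[of _ J])
        show "?f (?g y) \<in> extensional J" by simp
        show "y \<in> extensional J" using y by (simp add: PiE_iff)
        fix j assume j: "j \<in> J"
        have "y j \<in> extensional {i \<in> I. \<rho> i = j}" using y j by (simp add: PiE_iff)
        then show "?f (?g y) j = y j"
          using j by (intro extensionalityI[of _ "{i \<in> I. \<rho> i = j}"]) auto
      qed
    qed
    show "?f ` (\<Pi>\<^sub>E i\<in>I. carrier (M i)) \<subseteq> (\<Pi>\<^sub>E j\<in>J. \<Pi>\<^sub>E i\<in>{i \<in> I. \<rho> i = j}. carrier (M i))"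
      by (rule image_subsetI) (simp add: restrict_PiE_iff PiE_iff)
    show "?g ` (\<Pi>\<^sub>E j\<in>J. \<Pi>\<^sub>E i\<in>{i \<in> I. \<rho> i = j}. carrier (M i)) \<subseteq> (\<Pi>\<^sub>E i\<in>I. carrier (M i))"
      using \<rho>J by (auto simp: PiE_iff)
  qed
  show ?thesis
    unfolding module_iso_def direct_sum_def mem_Collect_eq module.simps ring.simps monoid.simps
      partial_object.simps
    by (intro conjI ballI bij restrict_ext) auto
qed

context chained_columns
begin

text \<open>The sum of all \<open>p\<^sup>sa\<^sub>C\<close> detects the columns with entry above \<open>s\<close>: its coordinate there is a
  power of \<open>p\<close> below \<open>p\<^bsup>\<beta> i\<^esup>\<close>.\<close>

lemma chain_submodule_eq_zero_iff:
  "chain_submodule s = {\<zero>\<^bsub>cyclic_sum R p I \<beta>\<^esub>} \<longleftrightarrow> (\<forall>i\<in>I. c i \<le> s)"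
proof
  assume zero: "chain_submodule s = {\<zero>\<^bsub>cyclic_sum R p I \<beta>\<^esub>}"
  have t: "(\<lambda>_. \<one>) \<in> UNIV \<rightarrow> carrier R" by simp
  have "residue R p I \<beta> (combination s (\<lambda>_. \<one>)) \<in> chain_submodule s"
    unfolding chain_submodule_def using t by (rule imageI)
  then have mem: "combination s (\<lambda>_. \<one>) i \<in> pow_ideal (\<beta> i)" if "i \<in> I" for i
    using zero residue_zero_iff[OF combination_closed[OF t], of \<beta> s] that by simp
  show "\<forall>i\<in>I. c i \<le> s"
  proof (rule ballI, rule ccontr)
    fix i assume i: "i \<in> I" "\<not> c i \<le> s"
    then have "\<beta> i - c i + s < \<beta> i" using level_le[OF i(1)] by simp
    from pow_notin_pow_ideal[OF this] mem[OF i(1)] show False by (simp add: combination_def)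
  qed
next
  assume le: "\<forall>i\<in>I. c i \<le> s"
  have "residue R p I \<beta> (combination s t) = \<zero>\<^bsub>cyclic_sum R p I \<beta>\<^esub>" if t: "t \<in> UNIV \<rightarrow> carrier R" for t
  proof -
    have "combination s t i \<in> pow_ideal (\<beta> i)" if "i \<in> I" for i
      unfolding combination_def using t le that level_le[OF that]
      by (intro pow_mult_in_pow_ideal) auto
    then show ?thesis using combination_closed[OF t] by (simp add: residue_zero_iff)
  qed
  then have "chain_submodule s \<subseteq> {\<zero>\<^bsub>cyclic_sum R p I \<beta>\<^esub>}" by (auto simp: chain_submodule_def)
  moreover have "chain_submodule s \<noteq> {}" by (auto simp: chain_submodule_def)
  ultimately show "chain_submodule s = {\<zero>\<^bsub>cyclic_sum R p I \<beta>\<^esub>}" by blast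
qed

lemma embedding_chain_submodule: "embedding R (chain_submodule 0) (cyclic_sum R p I \<beta>)"
  by (simp add: embedding_def module_cyclic_sum finite_length_cyclic_sum finite_I
      submodule_chain_submodule)

lemma cyclic_submodule_chain_submodule:
  assumes j: "\<And>i. i \<in> I \<Longrightarrow> \<rho> i = j"
  shows "cyclic_submodule R (chain_submodule 0) (cyclic_sum R p I \<beta>)"
proof -
  have one: "(\<lambda>_. \<one>) \<in> UNIV \<rightarrow> carrier R" by simp
  define x where "x = residue R p I \<beta> (combination 0 (\<lambda>_. \<one>))"
  have x: "x \<in> chain_submodule 0" unfolding x_def chain_submodule_def using one by (rule imageI)
  have smult: "a \<odot>\<^bsub>cyclic_sum R p I \<beta>\<^esub> x = residue R p I \<beta> (combination 0 t)"
    if a: "a \<in> carrier R" and t: "t j = a" for a t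
    unfolding x_def residue_smult[OF a combination_closed[OF one]]
    using a t by (intro residue_cong) (simp add: combination_def j m_comm)
  have "chain_submodule 0 = {a \<odot>\<^bsub>cyclic_sum R p I \<beta>\<^esub> x | a. a \<in> carrier R}"
  proof
    show "chain_submodule 0 \<subseteq> {a \<odot>\<^bsub>cyclic_sum R p I \<beta>\<^esub> x | a. a \<in> carrier R}"
    proof
      fix y assume "y \<in> chain_submodule 0"
      then obtain t where t: "t \<in> UNIV \<rightarrow> carrier R" "y = residue R p I \<beta> (combination 0 t)"
        by (auto simp: chain_submodule_def)
      then have "t j \<in> carrier R" by auto
      then show "y \<in> {a \<odot>\<^bsub>cyclic_sum R p I \<beta>\<^esub> x | a. a \<in> carrier R}"
        using smult[of "t j" t] t(2) by (intro CollectI exI[of _ "t j"]) simp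
    qed
    show "{a \<odot>\<^bsub>cyclic_sum R p I \<beta>\<^esub> x | a. a \<in> carrier R} \<subseteq> chain_submodule 0"
      using submodule.smult_closed[OF submodule_chain_submodule] x by blast
  qed
  then show ?thesis
    unfolding cyclic_submodule_def using x by (intro conjI submodule_chain_submodule bexI)
qed

text \<open>The summands are again of the form studied here, so that nothing has to be proved for them
  separately.\<close>

lemma restrict_to_chain: "chained_columns R p {i \<in> I. \<rho> i = j} \<beta> c pr \<rho>"
  by (unfold_locales)
    (use finite_I level_le pr_closed level_pr length_pr chain_pr chain_level_inj in \<open>simp_all\<close>)

text \<open>A member of \<open>A\<close> has one coefficient for each chain, and these can be chosen independently; hence
  regrouping the coordinates by chains carries \<open>A\<close> onto the product of its parts.\<close>

lemma ex_direct_sum_iso: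
  assumes J: "\<rho> ` I \<subseteq> J"
  defines "As \<equiv> \<lambda>j. chained_columns.chain_submodule R p {i \<in> I. \<rho> i = j} \<beta> c \<rho> 0"
    and "Bs \<equiv> \<lambda>j. cyclic_sum R p {i \<in> I. \<rho> i = j} \<beta>"
  shows "isomorphic_embeddings R (chain_submodule 0) (cyclic_sum R p I \<beta>)
    (\<Pi>\<^sub>E j\<in>J. As j) (direct_sum J Bs)"
proof -
  let ?C = "\<lambda>j. {i \<in> I. \<rho> i = j}"
  let ?f = "\<lambda>x. \<lambda>j\<in>J. \<lambda>i\<in>?C j. x i"
  have As: "As j = (\<lambda>t. residue R p (?C j) \<beta> (combination 0 t)) ` (UNIV \<rightarrow> carrier R)" for j
  proof -
    interpret chain: chained_columns R p "?C j" \<beta> c pr \<rho> by (rule restrict_to_chain)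
    show ?thesis by (simp add: As_def chain.chain_submodule_def)
  qed
  have f: "?f (residue R p I \<beta> v) = (\<lambda>j\<in>J. residue R p (?C j) \<beta> v)" for v
    by (auto simp: residue_def intro!: restrict_ext)
  have "?f ` chain_submodule 0 = (\<Pi>\<^sub>E j\<in>J. As j)"
  proof
    show "?f ` chain_submodule 0 \<subseteq> (\<Pi>\<^sub>E j\<in>J. As j)"
      unfolding chain_submodule_def As image_image f by auto
    show "(\<Pi>\<^sub>E j\<in>J. As j) \<subseteq> ?f ` chain_submodule 0"
    proof
      fix y assume y: "y \<in> (\<Pi>\<^sub>E j\<in>J. As j)"
      have "\<forall>j\<in>J. \<exists>t. t \<in> UNIV \<rightarrow> carrier R \<and> y j = residue R p (?C j) \<beta> (combination 0 t)"
      proof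
        fix j assume "j \<in> J"
        then have "y j \<in> As j" using y by auto
        then show "\<exists>t. t \<in> UNIV \<rightarrow> carrier R \<and> y j = residue R p (?C j) \<beta> (combination 0 t)"
          unfolding As by blast
      qed
      from bchoice[OF this] obtain t where t: "\<And>j. j \<in> J \<Longrightarrow> t j \<in> UNIV \<rightarrow> carrier R"
        "\<And>j. j \<in> J \<Longrightarrow> y j = residue R p (?C j) \<beta> (combination 0 (t j))"
        by blast
      define u where "u j = (if j \<in> J then t j j else \<zero>)" for j
      have u: "u \<in> UNIV \<rightarrow> carrier R" using t(1) by (simp add: u_def Pi_iff)
      have "y = ?f (residue R p I \<beta> (combination 0 u))"
        unfolding f
      proof (rule extensionalityI[of _ J])
        show "y \<in> extensional J" using y by (simp add: PiE_iff)
        fix j assume j: "j \<in> J"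
        have "residue R p (?C j) \<beta> (combination 0 (t j)) = residue R p (?C j) \<beta> (combination 0 u)"
          using j by (intro residue_cong) (simp add: combination_def u_def)
        then show "y j = (\<lambda>j\<in>J. residue R p (?C j) \<beta> (combination 0 u)) j" using t(2) j by simp
      qed simp
      then show "y \<in> ?f ` chain_submodule 0"
        unfolding chain_submodule_def image_image using u by (rule image_eqI)
    qed
  qed
  moreover have "?f \<in> module_iso R (cyclic_sum R p I \<beta>) (direct_sum J Bs)"
    using module_iso_regroup[OF J] unfolding cyclic_sum_def Bs_def .
  ultimately show ?thesis unfolding isomorphic_embeddings_def by blast
qed

end

text \<open>If \<open>p\<close> were zero, the zero ideal would be maximal and the ring a field. For \<open>u\<close> outside \<open>(p)\<close>
  maximality gives \<open>(p) + (u) = R\<close>, and an expression of \<open>1\<close> there yields the inverse modulo \<open>p\<close>.\<close>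

lemma maximal_element_uniformizer:
  assumes dvr: "discrete_valuation_ring R" and p: "uniformizer R p"
  shows "maximal_element R p"
proof -
  interpret principal_domain R using dvr by (simp add: discrete_valuation_ring_def)
  have pc: "p \<in> carrier R" and max: "maximalideal (PIdl\<^bsub>R\<^esub> p) R"
    using p by (simp_all add: uniformizer_def)
  interpret max: maximalideal "PIdl\<^bsub>R\<^esub> p" R by fact
  show ?thesis
  proof (intro maximal_element.intro maximal_element_axioms.intro domain_axioms)
    show "p \<in> carrier R" by fact
    show "p \<noteq> \<zero>\<^bsub>R\<^esub>"
    proof
      assume "p = \<zero>\<^bsub>R\<^esub>"
      then have "x = \<zero>\<^bsub>R\<^esub>" if "x \<in> PIdl\<^bsub>R\<^esub> p" for x
        using that unfolding cgenideal_def by fastforce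
      then have eq: "PIdl\<^bsub>R\<^esub> p = {\<zero>\<^bsub>R\<^esub>}" using max.zero_closed by blast
      have "field R" using max unfolding eq by (rule zeromaximalideal_fieldI)
      then show False using dvr by (simp add: discrete_valuation_ring_def)
    qed
    show "\<one>\<^bsub>R\<^esub> \<notin> PIdl\<^bsub>R\<^esub> p"
    proof
      assume "\<one>\<^bsub>R\<^esub> \<in> PIdl\<^bsub>R\<^esub> p"
      then have "PIdl\<^bsub>R\<^esub> p = carrier R" by (rule max.one_imp_carrier)
      then show False using max.I_notcarr by simp
    qed
    fix u assume u: "u \<in> carrier R" "u \<notin> PIdl\<^bsub>R\<^esub> p"
    interpret u: ideal "PIdl\<^bsub>R\<^esub> u" R by (rule cgenideal_ideal[OF u(1)])
    have sum: "ideal (PIdl\<^bsub>R\<^esub> p <+>\<^bsub>R\<^esub> PIdl\<^bsub>R\<^esub> u) R"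
      by (intro add_ideals max.ideal_axioms u.ideal_axioms)
    have sub: "x \<in> PIdl\<^bsub>R\<^esub> p <+>\<^bsub>R\<^esub> PIdl\<^bsub>R\<^esub> u" if "x \<in> PIdl\<^bsub>R\<^esub> p" for x
    proof -
      have "x = x \<oplus>\<^bsub>R\<^esub> \<zero>\<^bsub>R\<^esub>" using max.Icarr[OF that] by simp
      then show ?thesis using that u.zero_closed unfolding set_add_def' by blast
    qed
    have mem: "u \<in> PIdl\<^bsub>R\<^esub> p <+>\<^bsub>R\<^esub> PIdl\<^bsub>R\<^esub> u"
    proof -
      have "u = \<zero>\<^bsub>R\<^esub> \<oplus>\<^bsub>R\<^esub> u" using u(1) by simp
      then show ?thesis using cgenideal_self[OF u(1)] max.zero_closed unfolding set_add_def' by blast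
    qed
    have "PIdl\<^bsub>R\<^esub> p <+>\<^bsub>R\<^esub> PIdl\<^bsub>R\<^esub> u = PIdl\<^bsub>R\<^esub> p \<or>
        PIdl\<^bsub>R\<^esub> p <+>\<^bsub>R\<^esub> PIdl\<^bsub>R\<^esub> u = carrier R"
      using sub ideal.Icarr[OF sum] by (intro max.I_maximal[OF sum] subsetI)
    then have "PIdl\<^bsub>R\<^esub> p <+>\<^bsub>R\<^esub> PIdl\<^bsub>R\<^esub> u = carrier R" using mem u(2) by blast
    then have "\<one>\<^bsub>R\<^esub> \<in> PIdl\<^bsub>R\<^esub> p <+>\<^bsub>R\<^esub> PIdl\<^bsub>R\<^esub> u" by simp
    then obtain x b where x: "x \<in> PIdl\<^bsub>R\<^esub> p" and b: "b \<in> carrier R"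
      and one: "\<one>\<^bsub>R\<^esub> = x \<oplus>\<^bsub>R\<^esub> b \<otimes>\<^bsub>R\<^esub> u"
      unfolding set_add_def' cgenideal_def by blast
    have "\<one>\<^bsub>R\<^esub> \<ominus>\<^bsub>R\<^esub> b \<otimes>\<^bsub>R\<^esub> u = x"
      unfolding one using max.Icarr[OF x] b u(1) by (simp add: a_minus_def a_assoc r_neg)
    then show "\<exists>b\<in>carrier R. \<one>\<^bsub>R\<^esub> \<ominus>\<^bsub>R\<^esub> b \<otimes>\<^bsub>R\<^esub> u \<in> PIdl\<^bsub>R\<^esub> p"
      using x b by blast
  qed
qed

theorem corollary4p3:
  fixes R :: "('a, 'r) ring_scheme" and p :: 'a
    and \<alpha> \<beta> \<gamma> :: "nat \<Rightarrow> nat" and T :: "nat \<times> nat \<Rightarrow> nat"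
  assumes "discrete_valuation_ring R" and "uniformizer R p"
    and "is_partition \<alpha>" and "is_partition \<beta>" and "is_partition \<gamma>"
    and "LR_tableau \<alpha> \<beta> \<gamma> T"
    and "horizontal_strip \<beta> \<gamma>"
  shows "\<exists>(A :: (nat \<Rightarrow> 'a set) set) (B :: ('a, nat \<Rightarrow> 'a set) module).
           embedding R A B \<and>
           direct_sum_of_cyclic_embeddings R A B \<and>
           has_tableau R p A B (tableau_chain \<alpha> \<beta> \<gamma> T)"
proof -
  interpret LR_horizontal_strip \<alpha> \<beta> \<gamma> T
    by (rule LR_horizontal_strip.intro) (rule assms)+
  define I where "I = {i. \<beta> i \<noteq> 0}"
  from ex_level_chains obtain pr \<rho> where *: "level_chains {i. \<beta> i \<noteq> 0} \<beta> c pr \<rho> \<and>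
      (\<forall>i. \<beta> i \<noteq> 0 \<longrightarrow> \<beta> (\<rho> i) \<noteq> 0)"
    by (elim exE)
  have chains: "level_chains I \<beta> c pr \<rho>" using * unfolding I_def by (rule conjunct1)
  have root: "\<rho> i \<in> I" if "i \<in> I" for i using * that by (simp add: I_def)
  interpret chained_columns R p I \<beta> c pr \<rho>
    by (intro chained_columns.intro maximal_element_uniformizer assms chains)
  let ?A = "chain_submodule 0" and ?B = "cyclic_sum R p I \<beta>"
  have "direct_sum_of_cyclic_embeddings R ?A ?B"
  proof -
    \<comment> \<open>The summands are indexed by column numbers. Numbers that name no chain contribute zero modules.\<close>
    from finite_I obtain n where n: "I \<subseteq> {..<n}"
      unfolding finite_nat_iff_bounded by (elim exE)
    have cyclic: "cyclic_embedding R (chained_columns.chain_submodule R p {i \<in> I. \<rho> i = j} \<beta> c \<rho> 0)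
        (cyclic_sum R p {i \<in> I. \<rho> i = j} \<beta>)" for j
    proof -
      interpret chain: chained_columns R p "{i \<in> I. \<rho> i = j}" \<beta> c pr \<rho> by (rule restrict_to_chain)
      show ?thesis
        using chain.embedding_chain_submodule chain.cyclic_submodule_chain_submodule[of j]
        by (simp add: cyclic_embedding_def)
    qed
    have "\<rho> ` I \<subseteq> {..<n}" using root n by blast
    then show ?thesis
      unfolding direct_sum_of_cyclic_embeddings_def
      by (intro exI conjI allI impI) (rule cyclic, rule ex_direct_sum_iso)
  qed
  moreover have "has_tableau R p ?A ?B (tableau_chain \<alpha> \<beta> \<gamma> T)"
  proof -
    have "(\<forall>i\<in>I. c i \<le> s) \<longleftrightarrow> \<alpha> 0 \<le> s" for s
    proof
      assume le: "\<forall>i\<in>I. c i \<le> s"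
      show "\<alpha> 0 \<le> s"
      proof (rule ccontr)
        assume "\<not> \<alpha> 0 \<le> s"
        then obtain i where i: "c i = \<alpha> 0" using entry_occurs_iff[of "\<alpha> 0"] by auto
        then have "i \<in> I" using \<open>\<not> \<alpha> 0 \<le> s\<close> entry_pos_iff[of i] by (auto simp: I_def)
        then show False using le i \<open>\<not> \<alpha> 0 \<le> s\<close> by auto
      qed
    next
      assume "\<alpha> 0 \<le> s"
      moreover have "c i \<le> \<alpha> 0" for i using entry_occurs_iff[of "c i"] by (cases "c i = 0") auto
      ultimately show "\<forall>i\<in>I. c i \<le> s" using order_trans by blast
    qed
    then have "loewy_length R p ?A ?B = \<alpha> 0"
      unfolding loewy_length_def power_multiple_chain_submodule chain_submodule_eq_zero_iff
      by (simp add: Least_equality)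
    moreover have "isomorphic_modules R (partition_module R p (tableau_partition \<beta> \<gamma> T e))
        (quotient_module ?B (power_multiple R p ?B e ?A))" for e
    proof -
      have eq: "tableau_partition \<beta> \<gamma> T e = shrunk e"
        by (simp add: fun_eq_iff tableau_partition_strip shrunk_def)
      show ?thesis
        unfolding partition_module_eq_cyclic_sum eq
        by (rule quotient_by_power_multiple) (auto simp: I_def shrunk_def split: if_splits)
    qed
    ultimately show ?thesis
      by (simp add: has_tableau_def tableau_chain_def is_partition_tableau_partition del: upt_Suc)
  qed
  ultimately show ?thesis using embedding_chain_submodule by blast
qed

end
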